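(* Let $(\overline{K}(X)|K,v)$ be an extension of valued fields. Assume that $(K(X)|K,v)$ is value transcendental with a unique pair of definition $(a,\gamma)$. Let $\widehat{K}$ be the completion of $(K,v)$ and fix an extension of $v$ to $\overline{\widehat{K}}$. Take a complete sequence of key polynomials $\{Q_\nu\}_{\nu\in\Lambda}\cup\{Q_a\}$ for $v$ over $K$, where $Q_a$ is the minimal polynomial of $a$ over $K$. Then $\{Q_\nu\}_{\nu\in\Lambda'}\cup\{\widehat{Q}_a\}$ forms a complete sequence of key polynomials for the induced extension $(\widehat{K}(X)|\widehat{K},v)$, where $\widehat{Q}_a$ is the minimal polynomial of $a$ over $\widehat{K}$ and $\Lambda':=\{\nu\in\Lambda\mid\deg Q_\nu\le\deg\widehat{Q}_a\}$.
   Context: Valuations are Krull valuations written additively; $vL$, $Lv$ denote value group and residue field. $(K,v)$ is dense in $(L,v)$ if for every $a\in L$, $\gamma\in vL$ there is $b\in K$ with $v(a-b)>\gamma$; the completion $(\widehat{K},v)$ is the maximal extension in which $(K,v)$ is dense. $\overline{K}\subseteq\overline{\widehat{K}}$ are algebraic closures; the extension of $v$ to $\overline{\widehat{K}}$ is understood to extend both the valuation of $\widehat{K}$ and the given one on $\overline{K}$. $(K(X)|K,v)$ is value transcendental if $\dim_{\mathbb{Q}}\big((vK(X)/vK)\otimes\mathbb{Q}\big)=1$. For $a\in\overline{F}$ and $\gamma$ in an ordered abelian group containing $v\overline{F}$, $v_{a,\gamma}$ is the valuation on $\overline{F}(X)$ with $v_{a,\gamma}\big(\sum C_i(X-a)^i\big)=\min_i\{vC_i+i\gamma\}$.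 A pair $(a,\gamma)\in\overline{F}\times v\overline{F}(X)$ is a pair of definition for a valuation $v$ on $\overline{F}(X)$ over $F$ if $v=v_{a,\gamma}$. (If the pair of definition $(a,\gamma)$ is unique then $\gamma>v\overline{K}$, and every complete sequence of key polynomials for $v$ over $K$ has $Q_a$ as its final element; the index set $\Lambda$ in the claim indexes the remaining elements.) The induced extension: the valuation $v_{a,\gamma}$ on $\overline{\widehat{K}}(X)$ (formed from $v$ on $\overline{\widehat{K}}$) extends $v$ on $\overline{K}(X)$; its restriction to $\widehat{K}(X)$, again denoted $v$, gives the induced extension $(\widehat{K}(X)|\widehat{K},v)$. Key polynomials (for a valuation $v$ on $\overline{F}(X)$, over a base field $F$; for the induced extension use $F=\widehat{K}$ and the induced valuation on $\overline{\widehat{K}}(X)$): for nonconstant $f\in F[X]$ put $\delta(f):=\max\{v(X-a)\mid a\in\overline{F}\text{ a root of }f\}$. A nonconstant monic $Q\in F[X]$ is a key polynomial for $v$ over $F$ if $\delta(f)<\delta(Q)$ for every nonconstant $f\in F[X]$ with $\deg f<\deg Q$. For such $Q$ and $f=\sum f_iQ^i$ with $\deg f_i<\deg Q$, put $v_Q(f):=\min_i\{vf_i+i\,vQ\}$. A family $\Lambda$ of key polynomials for $v$ over $F$ is a complete sequence of key polynomials for $v$ over $F$ if: (1) $\delta(Q)\ne\delta(Q')$ for distinct $Q,Q'\in\Lambda$; (2) $\Lambda$ is well ordered by $Q<Q'\iff\delta(Q)<\delta(Q')$; (3) for every nonconstant $f\in F[X]$ there is $Q\in\Lambda$ with $\deg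 Q\le\deg f$ and $vf=v_Qf$. *)

theory Defs
  imports
    "HOL-Library.Extended"
    "HOL-Computational_Algebra.Polynomial_Factorial"
    "HOL-Algebra.Free_Abelian_Groups"
    "Jordan_Normal_Form.Missing_VectorSpace"
begin

section \<open>Fields and polynomials inside one ambient field\<close>

text \<open>
  All fields of constants are subsets \<open>F\<close> of one algebraically closed type \<open>'l\<close>, so that the
  inclusions between them are literal; \<open>F[X]\<close> and \<open>F(X)\<close> are then subsets of \<^typ>\<open>'l poly\<close> and
  \<^typ>\<open>'l poly fract\<close>.
\<close>

definition ring_on :: "'a::comm_ring_1 set \<Rightarrow> 'a ring" where
  "ring_on F = \<lparr>carrier = F, monoid.mult = (*), one = 1, ring.zero = 0, add = (+)\<rparr>"

definition polys_over :: "'l::field set \<Rightarrow> 'l poly set" where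
  "polys_over F = {p. \<forall>i. coeff p i \<in> F}"

definition ratfuns_over :: "'l::field set \<Rightarrow> 'l poly fract set" where
  "ratfuns_over F = {Fract p q | p q. p \<in> polys_over F \<and> q \<in> polys_over F \<and> q \<noteq> 0}"

text \<open>
  The relative algebraic closure of \<open>F\<close> in \<open>'l\<close>, which is an algebraic closure of \<open>F\<close> since \<open>'l\<close>
  is algebraically closed.
\<close>
definition alg_clos :: "'l::alg_closed_field set \<Rightarrow> 'l set" where
  "alg_clos F = {x. \<exists>p\<in>polys_over F. p \<noteq> 0 \<and> poly p x = 0}"

definition is_minimal_polynomial :: "'l::field set \<Rightarrow> 'l \<Rightarrow> 'l poly \<Rightarrow> bool" where
  "is_minimal_polynomial F a p \<longleftrightarrow>
     p \<in> polys_over F \<and> lead_coeff p = 1 \<and> poly p a = 0 \<and>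
     (\<forall>q\<in>polys_over F. q \<noteq> 0 \<and> poly q a = 0 \<longrightarrow> degree p \<le> degree q)"


section \<open>Valuations\<close>

locale valued_field = Ring.field R for R :: "('a, 'm) ring_scheme" (structure) +
  fixes v :: "'a \<Rightarrow> 'g::linordered_ab_group_add extended"
  assumes not_Minf: "x \<in> carrier R \<Longrightarrow> v x \<noteq> -\<infinity>"
    and eq_Pinf_iff: "x \<in> carrier R \<Longrightarrow> v x = \<infinity> \<longleftrightarrow> x = \<zero>"
    and mult: "x \<in> carrier R \<Longrightarrow> y \<in> carrier R \<Longrightarrow> v (x \<otimes> y) = v x + v y"
    and add: "x \<in> carrier R \<Longrightarrow> y \<in> carrier R \<Longrightarrow> min (v x) (v y) \<le> v (x \<oplus> y)"

definition value_group ::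
    "('a, 'm) ring_scheme \<Rightarrow> ('a \<Rightarrow> 'g::linordered_ab_group_add extended) \<Rightarrow> 'g set" where
  "value_group R v = {g. \<exists>x\<in>carrier R. v x = Fin g}"

definition dense_in ::
    "'a set \<Rightarrow> ('a, 'm) ring_scheme \<Rightarrow> ('a \<Rightarrow> 'g::linordered_ab_group_add extended) \<Rightarrow> bool" where
  "dense_in K L v \<longleftrightarrow>
     (\<forall>x\<in>carrier L. \<forall>\<gamma>\<in>value_group L v. \<exists>b\<in>K. Fin \<gamma> < v (x \<ominus>\<^bsub>L\<^esub> b))"

text \<open>
  \<open>(Khat, w)\<close> is the maximal extension of \<open>(K, w)\<close> in which \<open>K\<close> is dense: an embedding of
  valued fields \<open>Khat \<rightarrow> L\<close> such that the image of \<open>K\<close> is dense in \<open>L\<close> is onto. Maximality must be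
  tested against fields \<open>L\<close> not contained in \<open>'l\<close>. Restricting to carriers in \<^typ>\<open>'l set set\<close>
  loses nothing: a field in which \<open>K\<close> is dense has the same value group as \<open>K\<close>, and an element
  \<open>x\<close> of it is determined by the family of the sets \<open>{b \<in> K. u (x - b) > \<gamma>}\<close>.
\<close>
definition is_completion ::
    "'l::field set \<Rightarrow> 'l set \<Rightarrow> ('l \<Rightarrow> 'g::linordered_ab_group_add extended) \<Rightarrow> bool" where
  "is_completion K Khat w \<longleftrightarrow>
     Ring.field (ring_on K) \<and> K \<subseteq> Khat \<and> valued_field (ring_on Khat) w \<and>
     dense_in K (ring_on Khat) w \<and>
     (\<forall>(L :: 'l set set ring) (u :: 'l set set \<Rightarrow> 'g extended) \<phi>.
        valued_field L u \<and> \<phi> \<in> ring_hom (ring_on Khat) L \<and> (\<forall>x\<in>Khat. u (\<phi> x) = w x) \<and>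
        dense_in (\<phi> ` K) L u \<longrightarrow> \<phi> ` Khat = carrier L)"


section \<open>Value transcendental extensions\<close>

definition group_on :: "'g::ab_group_add set \<Rightarrow> 'g monoid" where
  "group_on H = \<lparr>carrier = H, monoid.mult = (+), one = 0\<rparr>"

text \<open>
  \<open>A \<otimes> \<rat>\<close> for an abelian group \<open>A\<close> (written multiplicatively): the free abelian group on
  \<open>A \<times> \<rat>\<close> modulo biadditivity, with \<open>\<rat>\<close> acting on the second factor.
\<close>

definition tensor_relations :: "'a monoid \<Rightarrow> ('a \<times> rat \<Rightarrow>\<^sub>0 int) set" where
  "tensor_relations A =
     {frag_of (x \<otimes>\<^bsub>A\<^esub> y, q) - frag_of (x, q) - frag_of (y, q) | x y q. x \<in> carrier A \<and> y \<in> carrier A} \<union>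
     {frag_of (x, q + r) - frag_of (x, q) - frag_of (x, r) | x q r. x \<in> carrier A}"

definition tensor_free :: "'a monoid \<Rightarrow> ('a \<times> rat \<Rightarrow>\<^sub>0 int) monoid" where
  "tensor_free A = free_Abelian_group (carrier A \<times> UNIV)"

definition tensor_kernel :: "'a monoid \<Rightarrow> ('a \<times> rat \<Rightarrow>\<^sub>0 int) set" where
  "tensor_kernel A = generate (tensor_free A) (tensor_relations A)"

definition tensor_scale :: "rat \<Rightarrow> ('a \<times> rat \<Rightarrow>\<^sub>0 int) \<Rightarrow> ('a \<times> rat \<Rightarrow>\<^sub>0 int)" where
  "tensor_scale q = frag_extend (\<lambda>(x, r). frag_of (x, q * r))"

definition tensor_rat :: "'a monoid \<Rightarrow> (rat, ('a \<times> rat \<Rightarrow>\<^sub>0 int) set) module" where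
  "tensor_rat A =
     \<lparr>carrier = carrier (tensor_free A Mod tensor_kernel A),
      monoid.mult = undefined, one = undefined,
      ring.zero = \<one>\<^bsub>tensor_free A Mod tensor_kernel A\<^esub>,
      add = monoid.mult (tensor_free A Mod tensor_kernel A),
      module.smult = (\<lambda>q C. \<Union>c\<in>C. tensor_kernel A #>\<^bsub>tensor_free A\<^esub> tensor_scale q c)\<rparr>"

lemma field_ring_on_UNIV: "Ring.field (ring_on (UNIV :: 'a::field set))"
proof -
  have "\<exists>y. x + y = 0" for x :: 'a using add.right_inverse by blast
  moreover have "x \<noteq> 0 \<Longrightarrow> \<exists>y. x * y = 1" for x :: 'a by (rule exI[of _ "inverse x"]) auto
  ultimately show ?thesis unfolding ring_on_def
    by unfold_locales (auto simp: algebra_simps Units_def)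
qed

lemma tensor_scale_diff: "tensor_scale q (c - d) = tensor_scale q c - tensor_scale q d"
  and tensor_scale_add: "tensor_scale q (c + d) = tensor_scale q c + tensor_scale q d"
  and tensor_scale_minus: "tensor_scale q (- c) = - tensor_scale q c"
  and tensor_scale_0 [simp]: "tensor_scale q 0 = 0"
  and tensor_scale_of [simp]: "tensor_scale q (frag_of (x, r)) = frag_of (x, q * r)"
  by (simp_all add: tensor_scale_def frag_extend_diff frag_extend_add frag_extend_minus)

lemma tensor_scale_scale: "tensor_scale q (tensor_scale r c) = tensor_scale (q * r) c"
proof -
  have "Poly_Mapping.keys c \<subseteq> UNIV" by simp
  then show ?thesis
    by (induction c rule: frag_induction) (auto simp: tensor_scale_diff mult.assoc)
qed

lemma tensor_scale_one: "tensor_scale 1 c = c"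
proof -
  have "Poly_Mapping.keys c \<subseteq> UNIV" by simp
  then show ?thesis
    by (induction c rule: frag_induction) (auto simp: tensor_scale_diff)
qed

lemma carrier_tensor_free: "c \<in> carrier (tensor_free A) \<longleftrightarrow> Poly_Mapping.keys c \<subseteq> carrier A \<times> UNIV"
  by (simp add: tensor_free_def)

lemma tensor_scale_closed:
  assumes "c \<in> carrier (tensor_free A)" shows "tensor_scale q c \<in> carrier (tensor_free A)"
  using assms unfolding carrier_tensor_free tensor_scale_def
  by (intro order.trans[OF keys_frag_extend]) auto

context
  fixes A :: "'a monoid"
  assumes A: "comm_group A"
begin

lemma relations_subset: "tensor_relations A \<subseteq> carrier (tensor_free A)"
proof -
  interpret comm_group A by (rule A)
  have D: "c - d \<in> carrier (tensor_free A)"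
    if "c \<in> carrier (tensor_free A)" "d \<in> carrier (tensor_free A)" for c d
    using that unfolding carrier_tensor_free by (meson Un_least keys_diff order.trans)
  have "frag_of (x, q) \<in> carrier (tensor_free A)" if "x \<in> carrier A" for x q
    using that by (simp add: carrier_tensor_free)
  then show ?thesis unfolding tensor_relations_def by (auto intro!: D)
qed

lemma comm_group_free: "comm_group (tensor_free A)"
  unfolding tensor_free_def by (rule abelian_free_Abelian_group)

lemma subgroup_kernel: "subgroup (tensor_kernel A) (tensor_free A)"
  unfolding tensor_kernel_def
  using comm_group_free relations_subset by (simp add: comm_group_def group.generate_is_subgroup)

lemma kernel_closed:
  "0 \<in> tensor_kernel A"
  "c \<in> tensor_kernel A \<Longrightarrow> d \<in> tensor_kernel A \<Longrightarrow> c + d \<in> tensor_kernel A"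
  "c \<in> tensor_kernel A \<Longrightarrow> - c \<in> tensor_kernel A"
  "c \<in> tensor_kernel A \<Longrightarrow> d \<in> tensor_kernel A \<Longrightarrow> c - d \<in> tensor_kernel A"
  "c \<in> tensor_kernel A \<Longrightarrow> c \<in> carrier (tensor_free A)"
proof -
  note S = subgroup_kernel
  show 0: "0 \<in> tensor_kernel A" using subgroup.one_closed[OF S] by (simp add: tensor_free_def)
  show C: "c \<in> carrier (tensor_free A)" if "c \<in> tensor_kernel A" for c
    using subgroup.mem_carrier[OF S that] .
  show add: "c + d \<in> tensor_kernel A" if "c \<in> tensor_kernel A" "d \<in> tensor_kernel A" for c d
    using subgroup.m_closed[OF S that] by (simp add: tensor_free_def)
  show m: "- c \<in> tensor_kernel A" if "c \<in> tensor_kernel A" for c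
    using subgroup.m_inv_closed[OF S that] C[OF that] by (simp add: tensor_free_def)
  show "c - d \<in> tensor_kernel A" if "c \<in> tensor_kernel A" "d \<in> tensor_kernel A" for c d
    using add[OF that(1) m[OF that(2)]] by simp
qed

lemma coset_eq: "tensor_kernel A #>\<^bsub>tensor_free A\<^esub> c = (\<lambda>k. k + c) ` tensor_kernel A"
  by (auto simp: r_coset_def tensor_free_def)

lemma coset_eqI:
  assumes "c - d \<in> tensor_kernel A"
  shows "tensor_kernel A #>\<^bsub>tensor_free A\<^esub> c = tensor_kernel A #>\<^bsub>tensor_free A\<^esub> d"
proof -
  have "k + c \<in> (\<lambda>k. k + d) ` tensor_kernel A" if "k \<in> tensor_kernel A" for k
    by (rule image_eqI[of _ _ "k + (c - d)"]) (use assms that in \<open>auto intro: kernel_closed\<close>)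
  moreover have "k + d \<in> (\<lambda>k. k + c) ` tensor_kernel A" if "k \<in> tensor_kernel A" for k
    by (rule image_eqI[of _ _ "k - (c - d)"]) (use assms that in \<open>auto intro: kernel_closed\<close>)
  ultimately show ?thesis unfolding coset_eq by blast
qed

lemma kernel_scale:
  assumes "c \<in> tensor_kernel A" shows "tensor_scale q c \<in> tensor_kernel A"
  using assms unfolding tensor_kernel_def
proof (induction rule: generate.induct)
  case one
  then show ?case using kernel_closed(1) by (simp add: tensor_free_def tensor_kernel_def)
next
  have *: "tensor_scale q c \<in> tensor_relations A" if "c \<in> tensor_relations A" for c
    using that unfolding tensor_relations_def
    by (fastforce simp: tensor_scale_diff distrib_left)
  case (incl c)
  then show ?case by (intro generate.incl *)
next
  case (inv c)
  have *: "tensor_scale q c \<in> tensor_relations A" if "c \<in> tensor_relations A" for c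
    using that unfolding tensor_relations_def
    by (fastforce simp: tensor_scale_diff distrib_left)
  have "tensor_scale q c \<in> tensor_kernel A"
    unfolding tensor_kernel_def using inv by (intro generate.incl *)
  moreover have "inv\<^bsub>tensor_free A\<^esub> c = - c"
    using inv relations_subset by (auto simp: tensor_free_def)
  ultimately show ?case using kernel_closed(3) by (simp add: tensor_scale_minus tensor_kernel_def)
next
  case (eng c d)
  then show ?case using kernel_closed(2)
    by (simp add: tensor_scale_add tensor_free_def tensor_kernel_def)
qed

lemma smult_coset:
  "q \<odot>\<^bsub>tensor_rat A\<^esub> (tensor_kernel A #>\<^bsub>tensor_free A\<^esub> c) =
   tensor_kernel A #>\<^bsub>tensor_free A\<^esub> tensor_scale q c"
proof -
  have "tensor_kernel A #>\<^bsub>tensor_free A\<^esub> tensor_scale q d =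
        tensor_kernel A #>\<^bsub>tensor_free A\<^esub> tensor_scale q c"
    if "d \<in> tensor_kernel A #>\<^bsub>tensor_free A\<^esub> c" for d
    using that unfolding coset_eq[of c]
    by (intro coset_eqI) (auto simp flip: tensor_scale_diff intro: kernel_scale)
  moreover have "c \<in> tensor_kernel A #>\<^bsub>tensor_free A\<^esub> c"
    unfolding coset_eq using kernel_closed(1) by force
  ultimately show ?thesis unfolding tensor_rat_def module.simps by (intro UN_constant_eq) blast+
qed

lemma add_coset:
  assumes "c \<in> carrier (tensor_free A)" "d \<in> carrier (tensor_free A)"
  shows "(tensor_kernel A #>\<^bsub>tensor_free A\<^esub> c) \<oplus>\<^bsub>tensor_rat A\<^esub> (tensor_kernel A #>\<^bsub>tensor_free A\<^esub> d) =
   tensor_kernel A #>\<^bsub>tensor_free A\<^esub> (c + d)"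
proof -
  interpret comm_group "tensor_free A" by (rule comm_group_free)
  interpret normal "tensor_kernel A" "tensor_free A"
    by (rule subgroup_imp_normal[OF subgroup_kernel])
  show ?thesis using rcos_sum[OF assms] by (simp add: tensor_rat_def) (simp add: tensor_free_def)
qed

lemma carrier_tensor_rat:
  "carrier (tensor_rat A) = (\<lambda>c. tensor_kernel A #>\<^bsub>tensor_free A\<^esub> c) ` carrier (tensor_free A)"
  by (simp add: tensor_rat_def carrier_FactGroup)

lemma smult_distrib_kernel:
  assumes "c \<in> carrier (tensor_free A)"
  shows "tensor_scale (q + r) c - (tensor_scale q c + tensor_scale r c) \<in> tensor_kernel A"
proof -
  have "Poly_Mapping.keys c \<subseteq> carrier A \<times> UNIV" using assms by (simp add: carrier_tensor_free)
  then show ?thesis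
  proof (induction c rule: frag_induction)
    case zero
    show ?case using kernel_closed(1) by simp
  next
    case (one x)
    then obtain y s where x: "x = (y, s)" "y \<in> carrier A" by auto
    have "frag_of (y, q * s + r * s) - frag_of (y, q * s) - frag_of (y, r * s) \<in> tensor_relations A"
      using x unfolding tensor_relations_def by blast
    then show ?case unfolding x tensor_kernel_def
      by (auto simp: distrib_right diff_diff_eq intro: generate.incl)
  next
    case (diff c d)
    have "tensor_scale (q + r) (c - d) - (tensor_scale q (c - d) + tensor_scale r (c - d)) =
      (tensor_scale (q + r) c - (tensor_scale q c + tensor_scale r c)) -
      (tensor_scale (q + r) d - (tensor_scale q d + tensor_scale r d))"
      by (simp add: tensor_scale_diff)
    then show ?case using diff kernel_closed(4) by metis
  qed
qed

lemma vectorspace_tensor_rat: "vectorspace (ring_on UNIV) (tensor_rat A)"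
proof -
  have F: "comm_group (tensor_free A Mod tensor_kernel A)"
    by (rule comm_group.abelian_FactGroup[OF comm_group_free subgroup_kernel])
  have ag: "abelian_group (tensor_rat A)"
  proof -
    interpret T: comm_group "tensor_free A Mod tensor_kernel A" by (rule F)
    show ?thesis
    proof (rule abelian_groupI)
      fix x assume "x \<in> carrier (tensor_rat A)"
      then show "\<exists>y\<in>carrier (tensor_rat A). y \<oplus>\<^bsub>tensor_rat A\<^esub> x = \<zero>\<^bsub>tensor_rat A\<^esub>"
        using T.l_inv_ex by (simp add: tensor_rat_def)
    qed (use T.m_closed T.one_closed T.m_assoc T.m_comm T.l_one in \<open>simp_all add: tensor_rat_def\<close>)
  qed
  have "module (ring_on UNIV) (tensor_rat A)"
  proof (rule moduleI)
    show "cring (ring_on (UNIV :: rat set))"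
      using field_ring_on_UNIV[where 'a = rat] by (simp add: Ring.field_def domain_def)
    show "abelian_group (tensor_rat A)" by (rule ag)
  next
    fix q :: rat and X assume "X \<in> carrier (tensor_rat A)"
    then show "q \<odot>\<^bsub>tensor_rat A\<^esub> X \<in> carrier (tensor_rat A)"
      unfolding carrier_tensor_rat by (auto simp: smult_coset tensor_scale_closed)
  next
    fix q r :: rat and X assume "X \<in> carrier (tensor_rat A)"
    then obtain c where c: "c \<in> carrier (tensor_free A)" "X = tensor_kernel A #>\<^bsub>tensor_free A\<^esub> c"
      unfolding carrier_tensor_rat by blast
    then show "(q \<oplus>\<^bsub>ring_on UNIV\<^esub> r) \<odot>\<^bsub>tensor_rat A\<^esub> X =
        q \<odot>\<^bsub>tensor_rat A\<^esub> X \<oplus>\<^bsub>tensor_rat A\<^esub> r \<odot>\<^bsub>tensor_rat A\<^esub> X"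
      using coset_eqI[OF smult_distrib_kernel[OF c(1)]]
      by (simp add: smult_coset add_coset tensor_scale_closed ring_on_def)
  next
    fix q :: rat and X Y assume "X \<in> carrier (tensor_rat A)" "Y \<in> carrier (tensor_rat A)"
    then show "q \<odot>\<^bsub>tensor_rat A\<^esub> (X \<oplus>\<^bsub>tensor_rat A\<^esub> Y) =
        q \<odot>\<^bsub>tensor_rat A\<^esub> X \<oplus>\<^bsub>tensor_rat A\<^esub> q \<odot>\<^bsub>tensor_rat A\<^esub> Y"
      unfolding carrier_tensor_rat
      by (auto simp: smult_coset add_coset tensor_scale_closed tensor_scale_add)
  next
    fix q r :: rat and X assume "X \<in> carrier (tensor_rat A)"
    then show "(q \<otimes>\<^bsub>ring_on UNIV\<^esub> r) \<odot>\<^bsub>tensor_rat A\<^esub> X =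
        q \<odot>\<^bsub>tensor_rat A\<^esub> (r \<odot>\<^bsub>tensor_rat A\<^esub> X)"
      unfolding carrier_tensor_rat by (auto simp: smult_coset tensor_scale_scale ring_on_def)
  next
    fix X assume "X \<in> carrier (tensor_rat A)"
    then show "\<one>\<^bsub>ring_on (UNIV :: rat set)\<^esub> \<odot>\<^bsub>tensor_rat A\<^esub> X = X"
      unfolding carrier_tensor_rat by (auto simp: smult_coset tensor_scale_one ring_on_def)
  qed
  then show ?thesis
    using field_ring_on_UNIV by (simp add: vectorspace_def)
qed

end

definition value_transcendental ::
    "'l::field set \<Rightarrow> ('l poly fract \<Rightarrow> 'g::linordered_ab_group_add extended) \<Rightarrow> bool" where
  "value_transcendental K v \<longleftrightarrow>
     (let vK = value_group (ring_on K) (\<lambda>c. v (to_fract [:c:]));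
          vKX = value_group (ring_on (ratfuns_over K)) v;
          V = tensor_rat (group_on vKX Mod vK)
      in vectorspace.fin_dim (ring_on UNIV) V \<and> vectorspace.dim (ring_on UNIV) V = 1)"


section \<open>Pairs of definition\<close>

definition nat_mult :: "nat \<Rightarrow> 'a::comm_monoid_add \<Rightarrow> 'a" where
  "nat_mult n x = (\<Sum>_<n. x)"

text \<open>The coefficients of \<open>p\<close> as a polynomial in \<open>X - a\<close> are those of \<open>p(X + a)\<close>.\<close>
definition pair_value ::
    "('l::field \<Rightarrow> 'g::linordered_ab_group_add extended) \<Rightarrow> 'l \<Rightarrow> 'g \<Rightarrow> 'l poly \<Rightarrow> 'g extended" where
  "pair_value w a \<gamma> p =
     (MIN i\<in>{..degree p}. w (coeff (pcompose p [:a, 1:]) i) + nat_mult i (Fin \<gamma>))"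

text \<open>
  \<open>u\<close> is the valuation \<open>v\<^sub>a\<^sub>,\<^sub>\<gamma>\<close> on the rational functions over the algebraic closure of \<open>F\<close>, formed
  from the valuation \<open>w\<close> of that closure.
\<close>
definition is_pair_valuation ::
    "'l::alg_closed_field set \<Rightarrow> ('l \<Rightarrow> 'g::linordered_ab_group_add extended) \<Rightarrow> 'l \<Rightarrow> 'g \<Rightarrow>
     ('l poly fract \<Rightarrow> 'g extended) \<Rightarrow> bool" where
  "is_pair_valuation F w a \<gamma> u \<longleftrightarrow>
     valued_field (ring_on (ratfuns_over (alg_clos F))) u \<and>
     (\<forall>p\<in>polys_over (alg_clos F). u (to_fract p) = pair_value w a \<gamma> p)"

definition is_pair_of_definition ::
    "'l::alg_closed_field set \<Rightarrow> ('l poly fract \<Rightarrow> 'g::linordered_ab_group_add extended) \<Rightarrow>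
     'l \<Rightarrow> 'g \<Rightarrow> bool" where
  "is_pair_of_definition F v a \<gamma> \<longleftrightarrow>
     a \<in> alg_clos F \<and> \<gamma> \<in> value_group (ring_on (ratfuns_over (alg_clos F))) v \<and>
     is_pair_valuation F (\<lambda>c. v (to_fract [:c:])) a \<gamma> v"


section \<open>Key polynomials\<close>

text \<open>The roots in \<open>'l\<close> of a nonzero \<open>f \<in> F[X]\<close> all lie in \<^term>\<open>alg_clos F\<close>.\<close>
definition delta ::
    "('l::field poly fract \<Rightarrow> 'g::linordered_ab_group_add extended) \<Rightarrow> 'l poly \<Rightarrow> 'g extended" where
  "delta v f = Max {v (to_fract [:- b, 1:]) | b. poly f b = 0}"

definition key_polynomial ::
    "'l::field set \<Rightarrow> ('l poly fract \<Rightarrow> 'g::linordered_ab_group_add extended) \<Rightarrow> 'l poly \<Rightarrow> bool" where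
  "key_polynomial F v Q \<longleftrightarrow>
     Q \<in> polys_over F \<and> 0 < degree Q \<and> lead_coeff Q = 1 \<and>
     (\<forall>f\<in>polys_over F. 0 < degree f \<and> degree f < degree Q \<longrightarrow> delta v f < delta v Q)"

definition adic_coeff :: "'l::field poly \<Rightarrow> 'l poly \<Rightarrow> nat \<Rightarrow> 'l poly" where
  "adic_coeff Q f i = (f div Q ^ i) mod Q"

lemma adic_expansion:
  fixes f Q :: "'l::field poly"
  assumes "0 < degree Q"
  shows "f = (\<Sum>i\<le>degree f. adic_coeff Q f i * Q ^ i)"
proof -
  have part: "f = (\<Sum>i<n. adic_coeff Q f i * Q ^ i) + (f div Q ^ n) * Q ^ n" for n
  proof (induction n)
    case (Suc n)
    have "f div Q ^ n = (f div Q ^ n div Q) * Q + adic_coeff Q f n"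
      by (simp add: adic_coeff_def)
    also have "f div Q ^ n div Q = f div Q ^ Suc n"
      by (simp only: power_Suc2 poly_div_mult_right)
    finally have step: "(f div Q ^ n) * Q ^ n = (f div Q ^ Suc n) * Q ^ Suc n + adic_coeff Q f n * Q ^ n"
      by (metis distrib_right mult.assoc power_Suc)
    have "f = (\<Sum>i<n. adic_coeff Q f i * Q ^ i) + (f div Q ^ n) * Q ^ n" by (rule Suc)
    also have "\<dots> = (\<Sum>i<Suc n. adic_coeff Q f i * Q ^ i) + (f div Q ^ Suc n) * Q ^ Suc n"
      unfolding step sum.lessThan_Suc by (simp only: add_ac)
    finally show ?case .
  qed simp
  have "degree f < degree (Q ^ Suc (degree f))"
  proof -
    have "degree (Q ^ Suc (degree f)) = Suc (degree f) * degree Q"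
      using assms by (intro degree_power_eq) auto
    moreover have "Suc (degree f) * 1 \<le> Suc (degree f) * degree Q"
      using assms by (intro mult_le_mono2) simp
    ultimately have "Suc (degree f) \<le> degree (Q ^ Suc (degree f))"
      by (simp only: mult_1_right)
    then show ?thesis by (rule Suc_le_lessD)
  qed
  then have 0: "f div Q ^ Suc (degree f) = 0" by (rule div_poly_less)
  show ?thesis
    using part[of "Suc (degree f)", unfolded 0 lessThan_Suc_atMost mult_zero_left add_0_right] .
qed

definition truncation ::
    "('l::field poly fract \<Rightarrow> 'g::linordered_ab_group_add extended) \<Rightarrow> 'l poly \<Rightarrow> 'l poly \<Rightarrow> 'g extended" where
  "truncation v Q f =
     (MIN i\<in>{..degree f}. v (to_fract (adic_coeff Q f i)) + nat_mult i (v (to_fract Q)))"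

definition complete_sequence ::
    "'l::field set \<Rightarrow> ('l poly fract \<Rightarrow> 'g::linordered_ab_group_add extended) \<Rightarrow> 'l poly set \<Rightarrow> bool" where
  "complete_sequence F v S \<longleftrightarrow>
     (\<forall>Q\<in>S. key_polynomial F v Q) \<and>
     (\<forall>Q\<in>S. \<forall>Q'\<in>S. Q \<noteq> Q' \<longrightarrow> delta v Q \<noteq> delta v Q') \<and>
     well_order_on S {(Q, Q'). Q \<in> S \<and> Q' \<in> S \<and> (Q = Q' \<or> delta v Q < delta v Q')} \<and>
     (\<forall>f\<in>polys_over F. 0 < degree f \<longrightarrow>
        (\<exists>Q\<in>S. degree Q \<le> degree f \<and> v (to_fract f) = truncation v Q f))"

end

(*
Uniqueness of the pair of definition forces \<gamma> to exceed the value of every nonzero constant, so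
vhat f = w (f a) whenever f a is nonzero, and delta f = \<gamma> exactly when a is a root of f. Since
K is dense in Khat, a polynomial over Khat of degree less than that of Qa_hat can be replaced by a
nearby one over K: continuity of roots then shows that the Q_\<nu> stay key polynomials. For a key
polynomial Q with Q a nonzero, choose a root a + d of Q with w d = delta Q. Then truncation at Q does
not decrease the value of f if and only if all coefficients of f (a + d Y) have value at least
w (f a), a condition that is stable under small perturbations of f, uniformly in Q because
the values delta Q are bounded below.
*)
theory Submission
  imports "HOL-Algebra.Finite_Extensions" Defs
begin

section \<open>Subfields and polynomials over them\<close>

text \<open>The obstacle is a circular dependence. An approximation \<open>g\<close> of
  \<open>f\<close> over \<open>K\<close> has to be chosen before the sequence supplies a
  \<open>Q\<close> that is exact on \<open>g\<close>, and the \<open>Q\<close>-adic expansions of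
  \<open>f\<close> and \<open>g\<close> are hard to compare without knowing \<open>Q\<close>. The
  rewritten criterion sees \<open>Q\<close> only through \<open>delta Q\<close>; the well order
  provides a least such value, and this value fixes the precision of \<open>g\<close> in advance.
  The criterion rests on one observation. Under \<open>X = a + d Y\<close>, a factor
  \<open>X - c\<close> with \<open>w (a - c) \<le> w d\<close> becomes a linear polynomial whose
  constant term has minimal value, and such factors multiply and cancel without loss in the Gauss
  valuation. A key polynomial and all its adic coefficients split into such factors. A second gap:
  density speaks only of values of \<open>Khat\<close>, while the precisions arise from roots in its
  algebraic closure. Cofinality of the values of \<open>Khat\<close> in those of the closure bridges
  it. In degrees from that of \<open>Qa_hat\<close> on, \<open>Qa_hat\<close> itself serves, since
  truncation at it is exact on every nonzero polynomial.\<close>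

lemma ring_on_simps [simp]:
  "carrier (ring_on F) = F" "x \<otimes>\<^bsub>ring_on F\<^esub> y = x * y" "\<one>\<^bsub>ring_on F\<^esub> = 1"
  "\<zero>\<^bsub>ring_on F\<^esub> = 0" "x \<oplus>\<^bsub>ring_on F\<^esub> y = x + y"
  by (simp_all add: ring_on_def)

lemma subfield_ring_on:
  fixes F :: "'a::field set"
  assumes "Ring.field (ring_on F)"
  shows "subfield F (ring_on UNIV)"
proof -
  interpret U: Ring.field "ring_on (UNIV :: 'a set)" by (rule field_ring_on_UNIV)
  show ?thesis using assms by (intro U.subfield_iff(1)) (simp_all add: ring_on_def)
qed

lemma a_inv_ring_on_UNIV [simp]: "\<ominus>\<^bsub>ring_on (UNIV :: 'a::field set)\<^esub> x = - x"
proof -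
  interpret U: Ring.field "ring_on (UNIV :: 'a set)" by (rule field_ring_on_UNIV)
  show ?thesis by (rule U.minus_equality) auto
qed

lemma m_inv_ring_on_UNIV: "x \<noteq> 0 \<Longrightarrow> inv\<^bsub>ring_on (UNIV :: 'a::field set)\<^esub> x = inverse x"
proof -
  interpret U: Ring.field "ring_on (UNIV :: 'a set)" by (rule field_ring_on_UNIV)
  show "x \<noteq> 0 \<Longrightarrow> inv\<^bsub>ring_on (UNIV :: 'a set)\<^esub> x = inverse x" by (rule U.comm_inv_char) auto
qed

lemma subfield_ring_on_closed:
  fixes F :: "'a::field set"
  assumes F: "subfield F (ring_on UNIV)"
  shows "0 \<in> F" "1 \<in> F" "x \<in> F \<Longrightarrow> y \<in> F \<Longrightarrow> x + y \<in> F" "x \<in> F \<Longrightarrow> - x \<in> F"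
    "x \<in> F \<Longrightarrow> y \<in> F \<Longrightarrow> x - y \<in> F" "x \<in> F \<Longrightarrow> y \<in> F \<Longrightarrow> x * y \<in> F"
    "x \<in> F \<Longrightarrow> inverse x \<in> F"
proof -
  interpret U: Ring.field "ring_on (UNIV :: 'a set)" by (rule field_ring_on_UNIV)
  note S = subringE[OF subfieldE(1)[OF F]]
  show "0 \<in> F" "1 \<in> F" and add: "x \<in> F \<Longrightarrow> y \<in> F \<Longrightarrow> x + y \<in> F" for x y using S by auto
  show uminus: "x \<in> F \<Longrightarrow> - x \<in> F" for x using S(5)[of x] by simp
  show "x \<in> F \<Longrightarrow> y \<in> F \<Longrightarrow> x - y \<in> F" using add[OF _ uminus, of x y] by simp
  show "x \<in> F \<Longrightarrow> y \<in> F \<Longrightarrow> x * y \<in> F" using S by auto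
  show "x \<in> F \<Longrightarrow> inverse x \<in> F"
    using U.subfield_m_inv(1)[OF F, of x] S(2) by (cases "x = 0") (auto simp: m_inv_ring_on_UNIV)
qed

lemma nat_pow_ring_on_UNIV [simp]: "x [^]\<^bsub>ring_on (UNIV :: 'a::field set)\<^esub> (n::nat) = x ^ n"
proof -
  interpret U: Ring.field "ring_on (UNIV :: 'a set)" by (rule field_ring_on_UNIV)
  show ?thesis by (induction n) (simp_all add: mult.commute)
qed

text \<open>HOL-Algebra lists coefficients with the leading one first, hence
  \<open>rev\<close>.\<close>

lemma eval_ring_on_UNIV:
  "ring.eval (ring_on (UNIV :: 'a::field set)) p x = poly (Poly (rev p)) x"
proof -
  interpret U: Ring.field "ring_on (UNIV :: 'a set)" by (rule field_ring_on_UNIV)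
  show ?thesis by (induction p) (simp_all add: Poly_append poly_monom)
qed

text \<open>The bridge through which the HOL-Algebra theorem that algebraic elements form a subfield
  becomes available for \<open>alg_clos\<close>.\<close>

lemma algebraic_over_iff_alg_clos:
  fixes F :: "'l::alg_closed_field set"
  assumes F: "subfield F (ring_on UNIV)"
  shows "(ring.algebraic (ring_on UNIV) over F) x \<longleftrightarrow> x \<in> alg_clos F"
proof -
  interpret U: Ring.field "ring_on (UNIV :: 'l set)" by (rule field_ring_on_UNIV)
  note S = subfieldE(1)[OF F]
  show ?thesis
  proof
    assume "(U.algebraic over F) x"
    then obtain p where p: "p \<in> carrier (F [X]\<^bsub>ring_on UNIV\<^esub>)" "p \<noteq> []" "U.eval p x = 0"
      using U.algebraicE[OF S, of x] by auto
    then have s: "set p \<subseteq> F" "hd p \<noteq> 0" by (auto simp: univ_poly_def polynomial_def)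
    have "Poly (rev p) \<in> polys_over F"
      using s(1) subfield_ring_on_closed(1)[OF F] 
      by (auto simp: polys_over_def coeff_Poly_eq nth_default_def rev_nth dest!: subsetD)
    moreover have "Polynomial.coeff (Poly (rev p)) (length p - 1) \<noteq> 0"
      using p(2) s(2) by (cases p) (auto simp: coeff_Poly_eq nth_default_def nth_append)
    then have "Poly (rev p) \<noteq> 0" by force
    ultimately show "x \<in> alg_clos F"
      using p(3) by (auto simp: alg_clos_def eval_ring_on_UNIV)
  next
    assume "x \<in> alg_clos F"
    then obtain p where p: "p \<in> polys_over F" "p \<noteq> 0" "poly p x = 0" by (auto simp: alg_clos_def)
    have ne: "coeffs p \<noteq> []" using p(2) by simp
    have "set (coeffs p) \<subseteq> F" using p(1) by (auto simp: polys_over_def coeffs_def)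
    then have "rev (coeffs p) \<in> carrier (F [X]\<^bsub>ring_on UNIV\<^esub>)"
      using p(2)
      by (simp add: univ_poly_def polynomial_def hd_rev last_coeffs_eq_coeff_degree)
    then show "(U.algebraic over F) x"
      using p ne by (intro U.algebraicI[of "rev (coeffs p)"]) (auto simp: eval_ring_on_UNIV)
  qed
qed

lemma subfield_alg_clos:
  fixes F :: "'l::alg_closed_field set"
  assumes F: "subfield F (ring_on UNIV)"
  shows "subfield (alg_clos F) (ring_on UNIV)"
proof -
  interpret U: Ring.field "ring_on (UNIV :: 'l set)" by (rule field_ring_on_UNIV)
  show ?thesis using U.subfield_of_algebraics[OF F] by (simp add: algebraic_over_iff_alg_clos[OF F])
qed

lemma subset_alg_clos:
  fixes F :: "'l::alg_closed_field set"
  assumes F: "subfield F (ring_on UNIV)"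
  shows "F \<subseteq> alg_clos F"
proof
  fix x assume "x \<in> F"
  then have "[:- x, 1:] \<in> polys_over F"
    using subfield_ring_on_closed[OF F] by (auto simp: polys_over_def coeff_pCons split: nat.splits)
  then show "x \<in> alg_clos F" unfolding alg_clos_def by (intro CollectI bexI[of _ "[:- x, 1:]"]) auto
qed

section \<open>Polynomials over a subfield: ring operations, monic division, adic
  coefficients\<close>

context
  fixes F :: "'a::field set"
  assumes F: "subfield F (ring_on UNIV)"
begin

lemma polys_over_0: "0 \<in> polys_over F"
  and polys_over_pCons_iff: "pCons x p \<in> polys_over F \<longleftrightarrow> x \<in> F \<and> p \<in> polys_over F"
  and polys_over_add: "p \<in> polys_over F \<Longrightarrow> q \<in> polys_over F \<Longrightarrow> p + q \<in> polys_over F"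
  and polys_over_diff: "p \<in> polys_over F \<Longrightarrow> q \<in> polys_over F \<Longrightarrow> p - q \<in> polys_over F"
  and polys_over_smult: "x \<in> F \<Longrightarrow> p \<in> polys_over F \<Longrightarrow> smult x p \<in> polys_over F"
  using subfield_ring_on_closed[OF F]
  by (auto simp: polys_over_def coeff_pCons split: nat.splits)

lemma polys_over_mult: "p \<in> polys_over F \<Longrightarrow> q \<in> polys_over F \<Longrightarrow> p * q \<in> polys_over F"
proof (induction p)
  case (pCons x p)
  then show ?case
    using subfield_ring_on_closed[OF F]
    by (auto simp: polys_over_pCons_iff intro!: polys_over_add polys_over_smult)
qed (simp add: polys_over_0)

lemma polys_over_pcompose: "p \<in> polys_over F \<Longrightarrow> q \<in> polys_over F \<Longrightarrow> pcompose p q \<in> polys_over F"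
proof (induction p)
  case (pCons x p)
  then show ?case
    by (auto simp: polys_over_pCons_iff pcompose_pCons polys_over_0 intro!: polys_over_add polys_over_mult)
qed (simp add: polys_over_0)

text \<open>For a monic divisor each new quotient digit is itself a coefficient of the running
  remainder, so coefficients never leave \<open>F\<close>.\<close>

lemma polys_over_divmod:
  assumes "p \<in> polys_over F" and Q: "Q \<in> polys_over F" "lead_coeff Q = 1"
  shows "p div Q \<in> polys_over F \<and> p mod Q \<in> polys_over F"
  using assms(1)
proof (induction p)
  case (pCons x p)
  have Q0: "Q \<noteq> 0" using Q by auto
  define r where "r = pCons x (p mod Q)"
  define c where "c = Polynomial.coeff r (degree Q)"
  have mod: "pCons x p mod Q = r - smult c Q"
    unfolding r_def c_def using Q by (simp add: mod_pCons Q0)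
  have div: "pCons x p div Q = pCons c (p div Q)"
    unfolding r_def c_def using Q by (simp add: div_pCons_eq Q0)
  have r: "r \<in> polys_over F" using pCons by (simp add: r_def polys_over_pCons_iff)
  then have "c \<in> F" by (simp add: c_def polys_over_def)
  then show ?case unfolding mod div using pCons r Q
    by (auto simp: polys_over_pCons_iff intro: polys_over_diff polys_over_smult)
qed (simp add: polys_over_0)

lemma polys_over_power: "Q \<in> polys_over F \<Longrightarrow> Q ^ n \<in> polys_over F"
  using subfield_ring_on_closed[OF F]
  by (induction n) (auto simp: polys_over_mult polys_over_pCons_iff polys_over_0 one_pCons)

lemma polys_over_adic_coeff:
  assumes "p \<in> polys_over F" "Q \<in> polys_over F" "lead_coeff Q = 1"
  shows "adic_coeff Q p i \<in> polys_over F"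
proof -
  have "lead_coeff (Q ^ i) = 1" using assms by (simp add: lead_coeff_power)
  then show ?thesis
    unfolding adic_coeff_def using assms by (metis polys_over_divmod polys_over_power)
qed

end

section \<open>Valuations of polynomial coefficients\<close>

lemma extended_add_right_mono: "x \<le> y \<Longrightarrow> x + z \<le> y + (z :: 'g::linordered_ab_group_add extended)"
  by (cases x; cases y; cases z) auto

lemma extended_add_Fin_le_iff [simp]:
  "x + Fin r \<le> y + Fin r \<longleftrightarrow> x \<le> (y :: 'g::linordered_ab_group_add extended)"
  "Fin r + x \<le> Fin r + y \<longleftrightarrow> x \<le> (y :: 'g::linordered_ab_group_add extended)"
  by (cases x; cases y; simp)+

lemma nat_mult_0 [simp]: "nat_mult 0 x = 0"
  and nat_mult_Suc [simp]: "nat_mult (Suc n) x = x + nat_mult n x"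
  by (simp_all add: nat_mult_def add.commute)

lemma nat_mult_add: "nat_mult (m + n) x = nat_mult m x + nat_mult n x"
  by (induction m) (simp_all add: add.assoc)

lemma nat_mult_Fin: "nat_mult n (Fin x) = Fin (nat_mult n x)"
  by (induction n) (simp_all add: zero_extended_def)

lemma adic_coeff_0: "adic_coeff Q f 0 = f mod Q"
  and adic_coeff_Suc: "adic_coeff Q f (Suc i) = adic_coeff Q (f div Q) i"
  by (simp_all add: adic_coeff_def poly_div_mult_right)

lemma adic_coeff_eq_0:
  assumes "0 < degree Q" "degree f < i"
  shows "adic_coeff Q f i = 0"
proof -
  have "degree (Q ^ i) = i * degree Q" using assms by (intro degree_power_eq) auto
  moreover have "i * 1 \<le> i * degree Q" using assms by (intro mult_le_mono2) simp
  ultimately have "degree f < degree (Q ^ i)" using assms(2) by (simp only: mult_1_right)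
  then show ?thesis by (simp add: adic_coeff_def div_poly_less)
qed

lemma alg_closed_factorization:
  fixes p :: "'l::alg_closed_field poly"
  assumes "p \<noteq> 0"
  obtains A where "p = smult (lead_coeff p) (\<Prod>c\<in>#A. [:- c, 1:])" "size A = degree p"
    "set_mset A = {c. poly p c = 0}"
proof -
  obtain A where A: "size A = degree p" "p = smult (lead_coeff p) (\<Prod>c\<in>#A. [:- c, 1:])"
    using alg_closed_imp_factorization[OF assms] by metis
  have "poly p c = 0 \<longleftrightarrow> c \<in># A" for c
  proof -
    have "poly p c = lead_coeff p * poly (\<Prod>c\<in>#A. [:- c, 1:]) c" by (subst A(2)) simp
    also have "\<dots> = 0 \<longleftrightarrow> c \<in># A" using assms by (auto simp: poly_prod_mset)
    finally show ?thesis .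
  qed
  then show ?thesis using that A by blast
qed

locale field_valuation =
  fixes w :: "'l::field \<Rightarrow> 'g::linordered_ab_group_add extended"
  assumes valued: "valued_field (ring_on UNIV) w"
begin

lemma w_mult: "w (x * y) = w x + w y"
  and w_add: "min (w x) (w y) \<le> w (x + y)"
  and w_neq_Minf [simp]: "w x \<noteq> -\<infinity>"
  and w_eq_Pinf_iff: "w x = \<infinity> \<longleftrightarrow> x = 0"
  using valued_field.mult[OF valued, of x y] valued_field.add[OF valued, of x y]
    valued_field.not_Minf[OF valued, of x] valued_field.eq_Pinf_iff[OF valued, of x]
  by simp_all

lemma w_0 [simp]: "w 0 = \<infinity>"
  by (simp add: w_eq_Pinf_iff)

lemma w_Fin:
  assumes "x \<noteq> 0"
  obtains r where "w x = Fin r"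
  using assms w_eq_Pinf_iff[of x] w_neq_Minf[of x] by (cases "w x") auto

lemma w_1 [simp]: "w 1 = 0"
proof -
  obtain r where "w 1 = Fin r" using w_Fin[of 1] by auto
  then show ?thesis using w_mult[of 1 1] by (simp add: zero_extended_def)
qed

lemma w_minus [simp]: "w (- x) = w x"
proof -
  obtain r where r: "w (-1) = Fin r" using w_Fin[of "-1"] by auto
  then have "r + r = 0" using w_mult[of "-1" "-1"] by (simp add: zero_extended_def)
  then have "w (-1) = 0" using r by (simp add: zero_extended_def double_zero)
  then show ?thesis using w_mult[of "-1" x] by simp
qed

lemma w_power: "w (x ^ n) = nat_mult n (w x)"
  by (induction n) (simp_all add: w_mult)

lemma w_add_ge: "t \<le> w x \<Longrightarrow> t \<le> w y \<Longrightarrow> t \<le> w (x + y)"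
  using w_add[of x y] by (meson min.boundedI order.trans)

lemma w_add_gt: "t < w x \<Longrightarrow> t < w y \<Longrightarrow> t < w (x + y)"
  using w_add[of x y] by (meson min_less_iff_conj order.strict_trans2)

lemma w_diff_ge: "t \<le> w x \<Longrightarrow> t \<le> w y \<Longrightarrow> t \<le> w (x - y)"
  using w_add_ge[of t x "- y"] by simp

lemma w_diff_commute: "w (x - y) = w (y - x)"
  using w_minus[of "x - y"] by simp

lemma w_sum_ge: "(\<And>i. i \<in> A \<Longrightarrow> t \<le> w (f i)) \<Longrightarrow> t \<le> w (sum f A)"
  by (induction A rule: infinite_finite_induct) (auto intro!: w_add_ge)

text \<open>The premise \<open>t < \<infinity>\<close> covers the empty sum, whose value is
  \<open>\<infinity>\<close>.\<close>

lemma w_sum_gt: "t < \<infinity> \<Longrightarrow> (\<And>i. i \<in> A \<Longrightarrow> t < w (f i)) \<Longrightarrow> t < w (sum f A)"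
  by (induction A rule: infinite_finite_induct) (auto intro!: w_add_gt)

lemma w_less_Pinf: "x \<noteq> 0 \<Longrightarrow> w x < \<infinity>"
  by (metis w_Fin less_extended_simps(2))

lemma w_add_eq: "w x < w y \<Longrightarrow> w (x + y) = w x"
  using w_add_ge[of "w x" x y] w_add_gt[of "w x" "x + y" "- y"] by fastforce

lemma w_mult_le_iff: "z \<noteq> 0 \<Longrightarrow> w (z * x) \<le> w (z * y) \<longleftrightarrow> w x \<le> w y"
  by (rule w_Fin[of z]) (auto simp: w_mult)

lemma w_mult_less_iff: "z \<noteq> 0 \<Longrightarrow> w (z * x) < w (z * y) \<longleftrightarrow> w x < w y"
  using w_mult_le_iff[of z y x] by (auto simp: not_le[symmetric])

lemma w_mult_mono: "w x \<le> w x' \<Longrightarrow> w y \<le> w y' \<Longrightarrow> w (x * y) \<le> w (x' * y')"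
  unfolding w_mult by (metis add.commute extended_add_right_mono order.trans)

lemma w_power_mono: "w x \<le> w y \<Longrightarrow> w (x ^ n) \<le> w (y ^ n)"
  by (induction n) (simp_all add: w_mult_mono)

text \<open>Merges two precision requirements into one that is again the value of a nonzero
  element.\<close>

lemma ex_w_upper_bound:
  assumes "x \<noteq> 0" "y \<noteq> 0"
  shows "\<exists>z. z \<noteq> 0 \<and> w x \<le> w z \<and> w y \<le> w z"
  using assms by (metis linear order.refl)

text \<open>This bounds the Gauss valuation of \<open>p\<close> from below. The bound is given by a
  field element, so that products of polynomials correspond to products of bounds;
  \<open>s = 0\<close> forces \<open>p = 0\<close>.\<close>

definition coeffs_ge :: "'l \<Rightarrow> 'l poly \<Rightarrow> bool" where
  "coeffs_ge s p \<longleftrightarrow> (\<forall>j. w s \<le> w (coeff p j))"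

lemma coeffs_ge_0 [simp]: "coeffs_ge s 0"
  by (simp add: coeffs_ge_def)

lemma coeffs_ge_add: "coeffs_ge s p \<Longrightarrow> coeffs_ge s q \<Longrightarrow> coeffs_ge s (p + q)"
  and coeffs_ge_diff: "coeffs_ge s p \<Longrightarrow> coeffs_ge s q \<Longrightarrow> coeffs_ge s (p - q)"
  by (auto simp: coeffs_ge_def intro: w_add_ge w_diff_ge)

lemma coeffs_ge_sum: "(\<And>i. i \<in> A \<Longrightarrow> coeffs_ge s (f i)) \<Longrightarrow> coeffs_ge s (sum f A)"
  by (auto simp: coeffs_ge_def coeff_sum intro: w_sum_ge)

lemma coeffs_ge_smult: "coeffs_ge s p \<Longrightarrow> coeffs_ge (c * s) (smult c p)"
  by (auto simp: coeffs_ge_def intro: w_mult_mono)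

lemma coeffs_ge_mult: "coeffs_ge s p \<Longrightarrow> coeffs_ge t q \<Longrightarrow> coeffs_ge (s * t) (p * q)"
  by (auto simp: coeffs_ge_def coeff_mult intro!: w_sum_ge w_mult_mono)

lemma coeffs_ge_trans: "w s \<le> w t \<Longrightarrow> coeffs_ge t p \<Longrightarrow> coeffs_ge s p"
  by (auto simp: coeffs_ge_def intro: order.trans)

lemma w_poly_ge:
  assumes "coeffs_ge s p" "0 \<le> w x"
  shows "w s \<le> w (poly p x)"
  unfolding poly_altdef
proof (rule w_sum_ge)
  fix i
  have "w (1 ^ i) \<le> w (x ^ i)" by (rule w_power_mono) (use assms in simp)
  then have "w (s * 1) \<le> w (coeff p i * x ^ i)"
    using assms by (intro w_mult_mono) (simp_all add: coeffs_ge_def)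
  then show "w s \<le> w (coeff p i * x ^ i)" by simp
qed

text \<open>A case of Gauss's lemma: coefficient \<open>j + 1\<close> of the product is
  \<open>e * coeff q (j + 1) + d * coeff q j\<close>, and the second summand is already bounded by
  induction because \<open>w e \<le> w d\<close>.\<close>

lemma coeffs_ge_cancel_linear:
  assumes "coeffs_ge s (q * [:e, d:])" "w e \<le> w d"
  shows "coeffs_ge s (smult e q)"
  unfolding coeffs_ge_def
proof
  have c: "coeff (q * [:e, d:]) j = e * coeff q j + (case j of 0 \<Rightarrow> 0 | Suc k \<Rightarrow> d * coeff q k)" for j
    by (subst mult.commute) (auto simp: coeff_pCons split: nat.splits)
  fix j
  show "w s \<le> w (coeff (smult e q) j)"
  proof (induction j)
    case 0
    then show ?case using assms(1) c[of 0] by (auto simp: coeffs_ge_def dest: spec[of _ 0])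
  next
    case (Suc j)
    have "w s \<le> w (d * coeff q j)"
      using Suc w_mult_mono[OF assms(2) order.refl, of "coeff q j"] by simp
    moreover have "w s \<le> w (coeff (q * [:e, d:]) (Suc j))" using assms(1) unfolding coeffs_ge_def by blast
    ultimately have "w s \<le> w (coeff (q * [:e, d:]) (Suc j) - d * coeff q j)" by (intro w_diff_ge)
    then show ?case by (simp add: c)
  qed
qed

lemma pcompose_linear: "pcompose [:- c, 1:] [:a, d:] = [:a - c, d :: 'l:]"
  by (simp add: pcompose_pCons algebra_simps)

text \<open>Each factor \<open>X - c\<close> becomes \<open>(a - c) + d Y\<close>, whose constant
  term has the smaller value; these bounds multiply up to the value of the product at
  \<open>a\<close>.\<close>

lemma coeffs_ge_pcompose_prod:
  assumes "\<And>c. c \<in># A \<Longrightarrow> w (a - c) \<le> w d"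
  shows "coeffs_ge (poly (\<Prod>c\<in>#A. [:- c, 1:]) a) (pcompose (\<Prod>c\<in>#A. [:- c, 1:]) [:a, d:])"
  using assms
proof (induction A)
  case empty
  show ?case by (simp add: coeffs_ge_def one_pCons coeff_pCons split: nat.splits)
next
  case (add c A)
  have "coeffs_ge (a - c) [:a - c, d:]"
    using add.prems by (simp add: coeffs_ge_def coeff_pCons split: nat.splits)
  then show ?case using coeffs_ge_mult[OF _ add.IH] add.prems
    by (simp add: pcompose_mult pcompose_linear left_diff_distrib[symmetric]
        del: mult_pCons_left mult_pCons_right)
qed

text \<open>Linear factors are cancelled one at a time, each leaving its constant term
  \<open>a - c\<close> behind as a scalar; \<open>q\<close> is arbitrary in the induction so that it
  can absorb the factors still to come.\<close>

lemma coeffs_ge_cancel_prod: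
  assumes "\<And>c. c \<in># A \<Longrightarrow> w (a - c) \<le> w d"
    and "coeffs_ge s (pcompose (q * (\<Prod>c\<in>#A. [:- c, 1:])) [:a, d:])"
  shows "coeffs_ge s (smult (poly (\<Prod>c\<in>#A. [:- c, 1:]) a) (pcompose q [:a, d:]))"
  using assms
proof (induction A arbitrary: q)
  case (add c A)
  let ?P = "\<Prod>c\<in>#A. [:- c, 1:]"
  have "coeffs_ge s (smult (poly ?P a) (pcompose (q * [:- c, 1:]) [:a, d:]))"
    by (rule add.IH) (use add.prems in \<open>auto simp: mult.assoc simp del: mult_pCons_left mult_pCons_right\<close>)
  then have "coeffs_ge s (smult (poly ?P a) (pcompose q [:a, d:]) * [:a - c, d:])"
    by (simp add: pcompose_mult pcompose_linear del: mult_pCons_left mult_pCons_right)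
  then have "coeffs_ge s (smult (a - c) (smult (poly ?P a) (pcompose q [:a, d:])))"
    by (rule coeffs_ge_cancel_linear) (use add.prems in auto)
  then show ?case by (simp add: left_diff_distrib)
qed simp

lemma w_poly_prod_eq:
  assumes "\<And>c. c \<in># A \<Longrightarrow> w (a - c) < w d"
  shows "w (poly (\<Prod>c\<in>#A. [:- c, 1:]) (a + d)) = w (poly (\<Prod>c\<in>#A. [:- c, 1:]) a)"
  using assms
proof (induction A)
  case (add c A)
  have "w (a + d - c) = w (a - c)"
    using w_add_eq[of "a - c" d] add.prems by (simp add: algebra_simps)
  then show ?case using add by (simp add: w_mult left_diff_distrib[symmetric])
qed simp

text \<open>The source of the continuity of roots, read contrapositively: a large value at
  \<open>x\<close> forces a root closer to \<open>x\<close> than \<open>e\<close>.\<close>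

lemma w_poly_prod_le:
  assumes "\<And>c. c \<in># A \<Longrightarrow> w (x - c) \<le> w e"
  shows "w (poly (\<Prod>c\<in>#A. [:- c, 1:]) x) \<le> w (e ^ size A)"
  using assms by (induction A) (auto simp: left_diff_distrib[symmetric] intro: w_mult_mono)

lemma ex_scale_coeffs:
  assumes "t \<noteq> 0"
  shows "\<exists>s. s \<noteq> 0 \<and> (\<forall>j. w t \<le> w (s * coeff r j))"
proof (induction r)
  case 0
  then show ?case by (intro exI[of _ 1]) simp
next
  case (pCons c r)
  then obtain s where s: "s \<noteq> 0" "\<And>j. w t \<le> w (s * coeff r j)" by auto
  obtain u where u: "u \<noteq> 0" "w t \<le> w (u * c)"
    using assms by (cases "c = 0") (auto intro: that[of 1] that[of "t / c"])
  obtain z where z: "z \<noteq> 0" "w s \<le> w z" "w u \<le> w z" using ex_w_upper_bound s(1) u(1) by blast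
  have "w t \<le> w (z * coeff r j)" for j
    using s(2)[of j] w_mult_mono[OF z(2) order.refl] order.trans by blast
  moreover have "w t \<le> w (z * c)" using u(2) w_mult_mono[OF z(3) order.refl] order.trans by blast
  ultimately show ?case using z(1) by (intro exI[of _ z]) (auto simp: coeff_pCons split: nat.splits)
qed

text \<open>Substituting \<open>r\<close> is continuous in the coefficients, uniformly for bounded
  degree. The induction uses Horner's form \<open>h = x + X h'\<close>: multiplication by
  \<open>r\<close> loses at most a fixed amount, which a stricter demand \<open>s\<close> on
  \<open>h'\<close> makes up for.\<close>

lemma ex_perturbation_bound:
  assumes "t \<noteq> 0"
  shows "\<exists>e. e \<noteq> 0 \<and> (\<forall>h. degree h \<le> n \<longrightarrow> (\<forall>i. w e < w (coeff h i)) \<longrightarrow>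
    (\<forall>j. w t < w (coeff (pcompose h r) j)))"
  using assms
proof (induction n arbitrary: t)
  case 0
  then show ?case
    by (intro exI[of _ t]) (auto simp: coeff_pCons w_less_Pinf elim!: degree_eq_zeroE split: nat.splits)
next
  case (Suc n)
  obtain s where s: "s \<noteq> 0" "\<And>j. w t \<le> w (s * coeff r j)" using ex_scale_coeffs[OF Suc.prems] by blast
  obtain e where e: "e \<noteq> 0"
    "\<And>h j. degree h \<le> n \<Longrightarrow> (\<forall>i. w e < w (coeff h i)) \<Longrightarrow> w s < w (coeff (pcompose h r) j)"
    using Suc.IH[OF s(1)] by blast
  obtain z where z: "z \<noteq> 0" "w e \<le> w z" "w t \<le> w z" using ex_w_upper_bound e(1) Suc.prems by blast
  have "w t < w (coeff (pcompose h r) j)"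
    if h: "degree h \<le> Suc n" "\<And>i. w z < w (coeff h i)" for h j
  proof -
    obtain x h' where h': "h = pCons x h'" by (cases h)
    have dh': "degree h' \<le> n" using h(1) by (auto simp: h' split: if_splits)
    have "w z < w x" "\<And>i. w z < w (coeff h' i)" using h(2)[of 0] h(2)[of "Suc _"] by (auto simp: h')
    then have x: "w t < w x" and h'': "\<And>i. w e < w (coeff h' i)" using z by (auto intro: order.strict_trans1)
    have *: "w s < w (coeff (pcompose h' r) k)" for k using e(2)[OF dh'] h'' by blast
    have "w t < w (coeff r i * coeff (pcompose h' r) k)" for i k
    \<comment> \<open>Strict inequalities survive multiplication only by nonzero factors; a zero
      coefficient gives a product of value \<open>\<infinity>\<close>.\<close>
    proof (cases "coeff r i = 0")
      case False
      then show ?thesis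
        using s(2)[of i] w_mult_less_iff[OF False, of s "coeff (pcompose h' r) k"] *[of k]
        by (simp add: mult.commute)
    qed (simp add: w_less_Pinf Suc.prems)
    then have "w t < w (coeff (r * pcompose h' r) j)"
      unfolding coeff_mult by (intro w_sum_gt w_less_Pinf Suc.prems)
    moreover have "w t < w (coeff [:x:] j)" using x Suc.prems by (simp add: coeff_pCons w_less_Pinf split: nat.splits)
    ultimately show ?thesis by (simp add: h' pcompose_pCons w_add_gt)
  qed
  then show ?case using z(1) by blast
qed

end

lemma pcompose_scale: "coeff (pcompose p [:a, d:]) j = d ^ j * coeff (pcompose p [:a, 1:]) j"
  for p :: "'l::field poly"
proof -
  have s: "coeff (pcompose q [:0, d:]) j = d ^ j * coeff q j" for q :: "'l poly"
    by (induction q arbitrary: j) (auto simp: pcompose_pCons coeff_pCons split: nat.splits)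
  have "pcompose p [:a, d:] = pcompose (pcompose p [:a, 1:]) [:0, d:]"
    by (simp add: pcompose_assoc[symmetric] pcompose_pCons)
  then show ?thesis by (simp add: s)
qed

lemma degree_mod_less_pos: "0 < degree Q \<Longrightarrow> degree (f mod Q) < degree Q"
  for Q :: "'l::field poly"
  by (cases "Q = 0") (use degree_mod_less[of Q f] in auto)

lemma coeff_0_pcompose: "coeff (pcompose p [:a, d:]) 0 = poly p a"
  by (induction p) (simp_all add: pcompose_pCons coeff_mult)

section \<open>Key polynomials and continuity of roots\<close>

locale alg_closed_valuation = field_valuation w
  for w :: "'l::alg_closed_field \<Rightarrow> 'g::linordered_ab_group_add extended"
begin

text \<open>Coefficient \<open>j\<close> carries the factor \<open>d ^ j\<close>, so only
  \<open>w d\<close> matters. This serves both to exchange \<open>d\<close> for another element of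
  equal value and to raise \<open>w d\<close>.\<close>

lemma coeffs_ge_pcompose_mono:
  assumes "coeffs_ge s (pcompose p [:a, d:])" "w d \<le> w d'"
  shows "coeffs_ge s (pcompose p [:a, d':])"
  using assms(1) w_mult_mono[OF w_power_mono[OF assms(2)] order.refl]
  unfolding coeffs_ge_def pcompose_scale[of p a d] pcompose_scale[of p a d'] by (meson order.trans)

text \<open>As \<open>poly p a\<close> is the constant coefficient after substitution, the Gauss
  valuation is attained there as long as no root lies closer to \<open>a\<close> than
  \<open>d\<close>.\<close>

lemma coeffs_ge_pcompose_roots:
  assumes "p \<noteq> 0" "\<And>c. poly p c = 0 \<Longrightarrow> w (a - c) \<le> w d"
  shows "coeffs_ge (poly p a) (pcompose p [:a, d:])"
proof -
  obtain A where A: "p = smult (lead_coeff p) (\<Prod>c\<in>#A. [:- c, 1:])" "set_mset A = {c. poly p c = 0}"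
    using alg_closed_factorization[OF assms(1)] by metis
  have "coeffs_ge (poly (\<Prod>c\<in>#A. [:- c, 1:]) a) (pcompose (\<Prod>c\<in>#A. [:- c, 1:]) [:a, d:])"
    using A(2) assms(2) by (intro coeffs_ge_pcompose_prod) auto
  then show ?thesis
    by (subst A(1), subst (2) A(1)) (simp add: pcompose_smult coeffs_ge_smult)
qed

lemma coeffs_ge_cancel_roots:
  assumes "lead_coeff P = 1" "\<And>c. poly P c = 0 \<Longrightarrow> w (a - c) \<le> w d"
    and "coeffs_ge s (smult e (pcompose (q * P) [:a, d:]))"
  shows "coeffs_ge s (smult (e * poly P a) (pcompose q [:a, d:]))"
proof -
  obtain A where A: "P = smult (lead_coeff P) (\<Prod>c\<in>#A. [:- c, 1:])" "set_mset A = {c. poly P c = 0}"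
    using alg_closed_factorization[of P] assms(1) by (metis leading_coeff_0_iff zero_neq_one)
  have P: "P = (\<Prod>c\<in>#A. [:- c, 1:])" using A(1) assms(1) by simp
  have "coeffs_ge s (smult (poly (\<Prod>c\<in>#A. [:- c, 1:]) a) (pcompose (smult e q) [:a, d:]))"
    by (rule coeffs_ge_cancel_prod) (use assms A(2) P in \<open>auto simp: pcompose_smult\<close>)
  then show ?thesis by (simp add: P pcompose_smult mult.commute)
qed

lemma w_poly_shift:
  assumes "\<And>c. p \<noteq> 0 \<Longrightarrow> poly p c = 0 \<Longrightarrow> w (a - c) < w d"
  shows "w (poly p (a + d)) = w (poly p a)"
proof (cases "p = 0")
  case False
  obtain A where A: "p = smult (lead_coeff p) (\<Prod>c\<in>#A. [:- c, 1:])" "set_mset A = {c. poly p c = 0}"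
    using alg_closed_factorization[OF False] by metis
  have "w (poly (\<Prod>c\<in>#A. [:- c, 1:]) (a + d)) = w (poly (\<Prod>c\<in>#A. [:- c, 1:]) a)"
    using A(2) assms False by (intro w_poly_prod_eq) auto
  then show ?thesis by (subst A(1), subst (3) A(1)) (simp add: w_mult)
qed simp

lemma w_poly_le:
  assumes "p \<noteq> 0" "\<And>c. poly p c = 0 \<Longrightarrow> w (x - c) \<le> w e"
  shows "w (poly p x) \<le> w (lead_coeff p * e ^ degree p)"
proof -
  obtain A where A: "p = smult (lead_coeff p) (\<Prod>c\<in>#A. [:- c, 1:])" "size A = degree p"
      "set_mset A = {c. poly p c = 0}"
    using alg_closed_factorization[OF assms(1)] by metis
  have "w (poly (\<Prod>c\<in>#A. [:- c, 1:]) x) \<le> w (e ^ size A)"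
    using A(3) assms(2) by (intro w_poly_prod_le) auto
  then show ?thesis
    by (subst A(1)) (auto simp: A(2) intro: w_mult_mono)
qed

section \<open>Adic terms at \<open>a\<close> versus the coefficients of
  \<open>f (a + d Y)\<close>\<close>

context
  fixes F :: "'l set" and Q :: "'l poly" and a d :: 'l
  assumes F: "subfield F (ring_on UNIV)"
    and Q: "Q \<in> polys_over F" "lead_coeff Q = 1" "0 < degree Q" "poly Q (a + d) = 0"
    and roots: "\<And>c. poly Q c = 0 \<Longrightarrow> w (a - c) \<le> w d"
    and small: "\<And>p c. p \<in> polys_over F \<Longrightarrow> p \<noteq> 0 \<Longrightarrow> degree p < degree Q \<Longrightarrow> poly p c = 0 \<Longrightarrow>
      w (a - c) < w d"
begin

text \<open>The root \<open>a + d\<close> of \<open>Q\<close> is the point \<open>Y = 1\<close>.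
  There \<open>f\<close> agrees with its remainder \<open>r\<close>, and \<open>r\<close> has the
  same value at \<open>a + d\<close> as at \<open>a\<close>, since all its roots are farther from
  \<open>a\<close> than \<open>d\<close>.\<close>

lemma w_remainder_ge:
  assumes "f \<in> polys_over F" "coeffs_ge s (smult e (pcompose f [:a, d:]))"
  shows "w s \<le> w (e * poly (f mod Q) a)"
proof -
  define r where "r = f mod Q"
  have dr: "degree r < degree Q" using Q(3) by (simp add: r_def degree_mod_less_pos)
  have rF: "r \<in> polys_over F" using polys_over_divmod[OF F] assms(1) Q by (simp add: r_def)
  have r: "w (poly r (a + d)) = w (poly r a)" using small rF dr by (intro w_poly_shift)
  have f: "f = f div Q * Q + r" by (simp add: r_def)
  have "poly f (a + d) = poly r (a + d)" by (subst f) (simp add: Q(4))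
  moreover have "poly f (a + d) = poly (pcompose f [:a, d:]) 1" by (simp add: poly_pcompose)
  moreover have "w s \<le> w (poly (smult e (pcompose f [:a, d:])) 1)"
    using assms(2) by (intro w_poly_ge) simp_all
  ultimately have "w s \<le> w (e * poly r (a + d))" by simp
  then show ?thesis using r by (simp add: w_mult r_def)
qed

text \<open>The remainder satisfies the coefficient bound, hence so does \<open>f div Q * Q\<close>;
  cancelling \<open>Q\<close> costs the scalar \<open>poly Q a\<close>. The parameter
  \<open>e\<close> accumulates these scalars, which become the power in the conclusion.\<close>

lemma w_adic_term_ge:
  assumes "f \<in> polys_over F" "coeffs_ge s (smult e (pcompose f [:a, d:]))"
  shows "w s \<le> w (e * (poly (adic_coeff Q f i) a * poly Q a ^ i))"
  using assms
proof (induction i arbitrary: e f)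
  case (0 e f)
  then show ?case using w_remainder_ge by (simp add: adic_coeff_0)
next
  case (Suc i e f)
  define r where "r = f mod Q"
  have dr: "degree r < degree Q" using Q(3) by (simp add: r_def degree_mod_less_pos)
  have rF: "r \<in> polys_over F" using polys_over_divmod[OF F] Suc.prems Q by (simp add: r_def)
  have f: "f = f div Q * Q + r" by (simp add: r_def)
  have ra: "w s \<le> w (e * poly r a)" unfolding r_def by (rule w_remainder_ge[OF Suc.prems])
  have "coeffs_ge s (smult e (pcompose r [:a, d:]))"
  proof (cases "r = 0")
    case False
    then have "coeffs_ge (poly r a) (pcompose r [:a, d:])"
      using small[OF rF False dr] by (intro coeffs_ge_pcompose_roots) (auto intro: order.strict_implies_order)
    then show ?thesis using ra by (blast intro: coeffs_ge_trans coeffs_ge_smult)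
  qed simp
  then have "coeffs_ge s (smult e (pcompose f [:a, d:]) - smult e (pcompose r [:a, d:]))"
    using Suc.prems by (intro coeffs_ge_diff)
  also have "smult e (pcompose f [:a, d:]) - smult e (pcompose r [:a, d:]) =
      smult e (pcompose (f div Q * Q) [:a, d:])"
    by (subst f) (simp add: pcompose_add smult_add_right)
  finally have "coeffs_ge s (smult (e * poly Q a) (pcompose (f div Q) [:a, d:]))"
    using roots Q(2) by (intro coeffs_ge_cancel_roots)
  then have "w s \<le> w (e * poly Q a * (poly (adic_coeff Q (f div Q) i) a * poly Q a ^ i))"
    using polys_over_divmod[OF F] Suc.prems Q by (intro Suc.IH) auto
  then show ?case by (simp add: adic_coeff_Suc mult_ac)
qed

text \<open>The roots of an adic term are roots of \<open>Q\<close> or of a polynomial of smaller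
  degree, none closer to \<open>a\<close> than \<open>d\<close>; so its value at \<open>a\<close>
  bounds all its coefficients in \<open>Y\<close>.\<close>

lemma coeffs_ge_pcompose_adic:
  assumes "f \<in> polys_over F" "\<And>i. w s \<le> w (poly (adic_coeff Q f i) a * poly Q a ^ i)"
  shows "coeffs_ge s (pcompose f [:a, d:])"
proof -
  have "coeffs_ge s (pcompose (adic_coeff Q f i * Q ^ i) [:a, d:])" for i
  proof (cases "adic_coeff Q f i = 0")
    case False
    let ?p = "adic_coeff Q f i"
    have p: "?p \<in> polys_over F" using polys_over_adic_coeff[OF F] assms(1) Q by simp
    have dp: "degree ?p < degree Q" using Q(3) by (simp add: adic_coeff_def degree_mod_less_pos)
    have "Q \<noteq> 0" using Q by auto
    have "w (a - c) \<le> w d" if "poly (?p * Q ^ i) c = 0" for c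
    proof (cases "poly Q c = 0")
      case False
      then have "poly ?p c = 0" using that by simp
      then show ?thesis using small[OF p \<open>?p \<noteq> 0\<close> dp] by (simp add: order.strict_implies_order)
    qed (rule roots)
    then have "coeffs_ge (poly (?p * Q ^ i) a) (pcompose (?p * Q ^ i) [:a, d:])"
      using False \<open>Q \<noteq> 0\<close> by (intro coeffs_ge_pcompose_roots) simp_all
    then show ?thesis using assms(2)[of i] by (auto intro: coeffs_ge_trans[rotated])
  qed simp
  then have "coeffs_ge s (\<Sum>i\<le>degree f. pcompose (adic_coeff Q f i * Q ^ i) [:a, d:])"
    by (intro coeffs_ge_sum)
  also have "\<dots> = pcompose (\<Sum>i\<le>degree f. adic_coeff Q f i * Q ^ i) [:a, d:]"
    by (simp only: pcompose_sum)
  also have "(\<Sum>i\<le>degree f. adic_coeff Q f i * Q ^ i) = f" by (rule adic_expansion[OF Q(3), symmetric])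
  finally show ?thesis .
qed

end

section \<open>Approximation of polynomials and of their roots over a dense subfield\<close>

context
  fixes K L :: "'l set"
  assumes K: "subfield K (ring_on UNIV)"
    and dense: "\<And>x e. x \<in> L \<Longrightarrow> e \<noteq> 0 \<Longrightarrow> \<exists>y\<in>K. w e < w (x - y)"
begin

lemma approx_poly_weak:
  assumes "f \<in> polys_over L" "e \<noteq> 0"
  shows "\<exists>g\<in>polys_over K. degree g \<le> degree f \<and> (\<forall>i. w e < w (coeff (f - g) i))"
  using assms(1)
proof (induction f)
  case 0
  then show ?case using assms(2) by (intro bexI[of _ 0]) (auto simp: w_less_Pinf polys_over_0[OF K])
next
  case (pCons x f)
  have *: "coeff (pCons x f) i \<in> L" for i using pCons.prems by (simp add: polys_over_def)
  have "x \<in> L" using *[of 0] by simp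
  then obtain y where y: "y \<in> K" "w e < w (x - y)" using dense assms(2) by blast
  have "f \<in> polys_over L" using *[of "Suc _"] by (simp add: polys_over_def)
  then obtain g where g: "g \<in> polys_over K" "degree g \<le> degree f" "\<And>i. w e < w (coeff (f - g) i)"
    using pCons.IH by blast
  show ?case
  proof (cases "f = 0")
    case True
    then show ?thesis using y assms(2)
      by (intro bexI[of _ "[:y:]"])
        (auto simp: polys_over_pCons_iff[OF K] polys_over_0[OF K] coeff_pCons w_less_Pinf split: nat.splits)
  next
    case False
    then show ?thesis using y g
      by (intro bexI[of _ "pCons y g"])
        (auto simp: polys_over_pCons_iff[OF K] coeff_pCons split: nat.splits)
  qed
qed

lemma approx_poly:
  assumes "f \<in> polys_over L" "f \<noteq> 0" "e \<noteq> 0"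
  shows "\<exists>g\<in>polys_over K. degree g = degree f \<and> w (lead_coeff g) = w (lead_coeff f) \<and>
    (\<forall>i. w e < w (coeff (f - g) i))"
proof -
  \<comment> \<open>A precision beyond the value of the leading coefficient keeps that coefficient
    nonzero, and so preserves the degree.\<close>
  obtain z where z: "z \<noteq> 0" "w (lead_coeff f) \<le> w z" "w e \<le> w z"
    using ex_w_upper_bound[of "lead_coeff f" e] assms by auto
  then obtain g where g: "g \<in> polys_over K" "degree g \<le> degree f" "\<And>i. w z < w (coeff (f - g) i)"
    using approx_poly_weak[OF assms(1), of z] by blast
  have "w (lead_coeff f) < w (coeff (f - g) (degree f))" using z(2) g(3) by (rule order.strict_trans1)
  then have "w (lead_coeff f) < w (coeff g (degree f) - lead_coeff f)"
    by (simp add: w_diff_commute[of "coeff g (degree f)" "lead_coeff f"])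
  from w_add_eq[OF this] have *: "w (coeff g (degree f)) = w (lead_coeff f)" by simp
  then have "coeff g (degree f) \<noteq> 0"
    using assms(2) w_eq_Pinf_iff[of "lead_coeff f"] by auto
  then have "degree g = degree f" using g(2) le_degree[of g "degree f"] by simp
  then have "w (lead_coeff g) = w (lead_coeff f)" using * by simp
  moreover have "w e < w (coeff (f - g) i)" for i using z(3) g(3)[of i] by (rule order.strict_trans1)
  ultimately show ?thesis using g(1) \<open>degree g = degree f\<close> by blast
qed

lemma approx_root:
  assumes "f \<in> polys_over L" "f \<noteq> 0" "poly f b = 0" "\<rho> \<noteq> 0"
  shows "\<exists>g\<in>polys_over K. degree g = degree f \<and> (\<exists>c. poly g c = 0 \<and> w \<rho> < w (b - c))"
proof -
  \<comment> \<open>\<open>w t\<close> is the largest value a polynomial of this degree and leading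
    value can take at \<open>b\<close> when no root is closer to \<open>b\<close> than
    \<open>\<rho>\<close>.\<close>
  define t where "t = lead_coeff f * \<rho> ^ degree f"
  have t: "t \<noteq> 0" using assms by (simp add: t_def)
  obtain e where e: "e \<noteq> 0" "\<And>h j. degree h \<le> degree f \<Longrightarrow> (\<forall>i. w e < w (coeff h i)) \<Longrightarrow>
      w t < w (coeff (pcompose h [:b, 1:]) j)"
    using ex_perturbation_bound[OF t, of "degree f" "[:b, 1:]"] by blast
  obtain g where g: "g \<in> polys_over K" "degree g = degree f" "w (lead_coeff g) = w (lead_coeff f)"
      "\<And>i. w e < w (coeff (f - g) i)"
    using approx_poly[OF assms(1,2) e(1)] by blast
  have "degree (f - g) \<le> degree f" using g(2) by (intro degree_diff_le) auto
  then have "w t < w (coeff (pcompose (f - g) [:b, 1:]) 0)" using e(2) g(4) by blast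
  then have gb: "w t < w (poly g b)" using assms(3) by (simp add: coeff_0_pcompose)
  have g0: "g \<noteq> 0" using g(3) assms(2) w_eq_Pinf_iff[of "lead_coeff f"] by auto
  have "\<exists>c. poly g c = 0 \<and> w \<rho> < w (b - c)"
  proof (rule ccontr)
    assume "\<nexists>c. poly g c = 0 \<and> w \<rho> < w (b - c)"
    then have "w (poly g b) \<le> w (lead_coeff g * \<rho> ^ degree g)"
      using g0 by (intro w_poly_le) (auto simp: not_less)
    also have "\<dots> = w t" by (unfold t_def w_mult g(3)) (simp add: g(2))
    finally show False using gb by simp
  qed
  then show ?thesis using g by blast
qed

end

text \<open>A relation \<open>c + x * poly p x = 0\<close> with \<open>c\<close> nonzero bounds
  \<open>w x\<close>: for \<open>0 \<le> w x\<close>, the value of \<open>poly p x\<close> is at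
  least the least coefficient value of \<open>p\<close>. Leading factors \<open>X\<close> of the
  relation are stripped by the induction.\<close>

lemma cofinal_subfield:
  assumes F: "subfield F (ring_on UNIV)" and "x \<in> alg_clos F" "x \<noteq> 0"
  shows "\<exists>c\<in>F. c \<noteq> 0 \<and> w x \<le> w c"
proof (cases "0 \<le> w x")
  case True
  obtain p where p: "p \<in> polys_over F" "p \<noteq> 0" "poly p x = 0" using assms by (auto simp: alg_clos_def)
  then show ?thesis
  proof (induction p)
    case (pCons c p)
    have pF: "c \<in> F" "p \<in> polys_over F" using pCons.prems polys_over_pCons_iff[OF F] by auto
    show ?case
    proof (cases "c = 0")
      case True
      then show ?thesis using pCons pF assms(3) by auto
    next
      case False
      have p0: "p \<noteq> 0" using pCons.prems False by auto
      have c: "c = - (x * poly p x)" using pCons.prems(3) by (simp add: eq_neg_iff_add_eq_0)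
      \<comment> \<open>A coefficient of least value is wanted, because \<open>c\<close> divided by
        it is the bounding element of \<open>F\<close>.\<close>
      define M where "M = Min (w ` coeff p ` {..degree p})"
      have "M \<in> w ` coeff p ` {..degree p}" unfolding M_def by (intro Min_in) auto
      then obtain i where i: "M = w (coeff p i)" by auto
      have Mle: "M \<le> w (coeff p j)" for j
      proof (cases "j \<le> degree p")
        case True
        then show ?thesis unfolding M_def by (intro Min_le) auto
      qed (simp add: coeff_eq_0)
      have ci: "coeff p i \<noteq> 0"
      proof
        assume "coeff p i = 0"
        then have "w (lead_coeff p) = \<infinity>" using Mle[of "degree p"] i by simp
        then show False using p0 by (simp add: w_eq_Pinf_iff)
      qed
      have "coeffs_ge (coeff p i) p" using Mle i by (simp add: coeffs_ge_def)
      then have "w (coeff p i) \<le> w (poly p x)" using True \<open>0 \<le> w x\<close> by (intro w_poly_ge)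
      then have "w (coeff p i * x) \<le> w (poly p x * x)" by (intro w_mult_mono) simp_all
      also have "w (poly p x * x) = w c" using arg_cong[OF c, of w] by (simp add: mult.commute)
      also have "c = coeff p i * (c / coeff p i)" using ci by simp
      finally have "w x \<le> w (c / coeff p i)" using w_mult_le_iff[OF ci] by blast
      moreover have "c / coeff p i \<in> F"
        using pF subfield_ring_on_closed[OF F] by (simp add: polys_over_def divide_inverse)
      ultimately show ?thesis using False ci by (intro bexI[of _ "c / coeff p i"]) auto
    qed
  qed simp
next
  case False
  then show ?thesis using subfield_ring_on_closed(2)[OF F] by (intro bexI[of _ 1]) auto
qed

end

section \<open>Pairs of definition\<close>

lemma le_nat_mult:
  fixes \<gamma> :: "'g::linordered_ab_group_add"
  assumes "0 \<le> \<gamma>" "0 < i"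
  shows "\<gamma> \<le> nat_mult i \<gamma>"
proof -
  have "0 \<le> nat_mult n \<gamma>" for n by (induction n) (use assms in auto)
  then show ?thesis using assms(2) by (cases i) simp_all
qed

section \<open>Invariance of \<open>pair_value\<close> under small shifts of the centre\<close>

context field_valuation
begin

lemma le_pair_value_iff:
  "t \<le> pair_value w a \<gamma> p \<longleftrightarrow>
    (\<forall>i. t \<le> w (coeff (pcompose p [:a, 1:]) i) + Fin (nat_mult i \<gamma>))"
proof -
  have "t \<le> w (coeff (pcompose p [:a, 1:]) i) + Fin (nat_mult i \<gamma>)" if "degree p < i" for i
  proof -
    have "coeff (pcompose p [:a, 1:]) i = 0"
      using that by (intro coeff_eq_0) (simp add: degree_pcompose)
    then show ?thesis by simp
  qed
  then have "(\<forall>i. t \<le> w (coeff (pcompose p [:a, 1:]) i) + Fin (nat_mult i \<gamma>)) \<longleftrightarrow>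
      (\<forall>i\<in>{..degree p}. t \<le> w (coeff (pcompose p [:a, 1:]) i) + Fin (nat_mult i \<gamma>))"
    by (meson atMost_iff not_le)
  then show ?thesis unfolding pair_value_def nat_mult_Fin by (subst Min_ge_iff) auto
qed

lemma pair_value_linear: "pair_value w a \<gamma> [:- b, 1:] = min (w (a - b)) (Fin \<gamma>)"
proof -
  have "pcompose [:- b, 1:] [:a, 1:] = [:a - b, 1:]" by (rule pcompose_linear)
  then have "pair_value w a \<gamma> [:- b, 1:] =
    Min ((\<lambda>i. w (coeff [:a - b, 1:] i) + nat_mult i (Fin \<gamma>)) ` {0, 1})"
    by (simp only: pair_value_def) (simp add: atMost_Suc insert_commute)
  then show ?thesis by simp
qed

lemma w_add_offset_ge:
  "t \<le> w x + Fin r \<Longrightarrow> t \<le> w y + Fin r \<Longrightarrow> t \<le> w (x + y) + Fin r"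
  using extended_add_right_mono[OF w_add[of x y], of "Fin r"]
  by (cases "w x \<le> w y") (auto simp: min_absorb1 min_absorb2 simp del: extended_add_Fin_le_iff
      dest: order.trans)

text \<open>In the Taylor shift a power of \<open>Y\<close> may be traded for \<open>c\<close>, and
  \<open>w c\<close> is at least its weight \<open>\<gamma>\<close>. The offset \<open>r\<close>
  makes the induction work: dropping the lowest coefficient lowers each index by one, so
  \<open>r\<close> grows by \<open>\<gamma>\<close>.\<close>

lemma coeff_shift_offset_ge:
  assumes "Fin \<gamma> \<le> w c"
    and "\<And>i. t \<le> w (coeff q i) + Fin (r + nat_mult i \<gamma>)"
  shows "t \<le> w (coeff (pcompose q [:c, 1:]) j) + Fin (r + nat_mult j \<gamma>)"
  using assms(2)
proof (induction q arbitrary: r j)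
  case (pCons x q)
  let ?q = "pcompose q [:c, 1:]"
  have "t \<le> w (coeff q i) + Fin (r + \<gamma> + nat_mult i \<gamma>)" for i
    using pCons.prems[of "Suc i"] by (simp add: add_ac)
  note IH = pCons.IH[OF this]
  have 1: "t \<le> w (c * coeff ?q j) + Fin (r + nat_mult j \<gamma>)" for j
  proof -
    have "t \<le> Fin \<gamma> + (w (coeff ?q j) + Fin (r + nat_mult j \<gamma>))"
      using IH[of j] by (simp add: add_ac flip: plus_extended.simps(1))
    also have "\<dots> \<le> w c + (w (coeff ?q j) + Fin (r + nat_mult j \<gamma>))"
      by (rule extended_add_right_mono[OF assms(1)])
    finally show ?thesis by (simp add: w_mult add.assoc)
  qed
  have eq: "coeff (pcompose (pCons x q) [:c, 1:]) j =
      (case j of 0 \<Rightarrow> x | Suc k \<Rightarrow> coeff ?q k) + c * coeff ?q j"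
    by (simp add: pcompose_pCons coeff_pCons split: nat.splits)
  show ?case unfolding eq
  proof (rule w_add_offset_ge)
    show "t \<le> w (case j of 0 \<Rightarrow> x | Suc k \<Rightarrow> coeff ?q k) + Fin (r + nat_mult j \<gamma>)"
      using pCons.prems[of 0] IH by (cases j) (simp_all add: add.assoc)
  qed (rule 1)
qed simp

lemma pair_value_shift_le:
  assumes "Fin \<gamma> \<le> w c"
  shows "pair_value w a \<gamma> p \<le> pair_value w (a + c) \<gamma> p"
proof -
  let ?q = "pcompose p [:a, 1:]"
  have q: "pcompose p [:a + c, 1:] = pcompose ?q [:c, 1:]"
    by (simp add: pcompose_assoc[symmetric] pcompose_pCons)
  have "pair_value w a \<gamma> p \<le> w (coeff ?q i) + Fin (0 + nat_mult i \<gamma>)" for i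
    using le_pair_value_iff[of "pair_value w a \<gamma> p" a \<gamma> p] by simp
  then show ?thesis unfolding le_pair_value_iff[of _ "a + c"] q
    using coeff_shift_offset_ge[OF assms, of _ ?q 0] by simp
qed

text \<open>The one-sided bound is applied to \<open>c\<close> and, back from \<open>a + c\<close>,
  to \<open>- c\<close>.\<close>

lemma pair_value_shift: "Fin \<gamma> \<le> w c \<Longrightarrow> pair_value w (a + c) \<gamma> p = pair_value w a \<gamma> p"
  using pair_value_shift_le[of \<gamma> c a p] pair_value_shift_le[of \<gamma> "- c" "a + c" p]
  by (simp add: order.antisym)

end

lemma degree_pos_if_root: "p \<noteq> 0 \<Longrightarrow> poly p c = 0 \<Longrightarrow> 0 < degree p"
  for p :: "'l::field poly"
  by (rule ccontr) (auto elim: degree_eq_zeroE)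

text \<open>Here \<open>u\<close> is the valuation with centre \<open>a\<close> and radius
  \<open>\<gamma>\<close> on the full closure. Dominance makes it compare first the order of
  vanishing at \<open>a\<close>, then the value of the lowest nonzero Taylor coefficient.\<close>

locale dominant_pair = alg_closed_valuation w
  for w :: "'l::alg_closed_field \<Rightarrow> 'g::linordered_ab_group_add extended" +
  fixes a :: 'l and \<gamma> :: 'g and u :: "'l poly fract \<Rightarrow> 'g extended"
  assumes u_mult: "u (to_fract (p * q)) = u (to_fract p) + u (to_fract q)"
    and u_poly: "u (to_fract p) = pair_value w a \<gamma> p"
    and dominant: "c \<noteq> 0 \<Longrightarrow> w c < Fin \<gamma>"
begin

lemma u_linear: "u (to_fract [:- b, 1:]) = (if b = a then Fin \<gamma> else w (a - b))"
  using dominant[of "a - b"] by (auto simp: u_poly pair_value_linear)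

lemma le_u_poly:
  assumes "x \<noteq> 0" "w x \<le> w (poly p a)"
  shows "w x \<le> u (to_fract p)"
  unfolding u_poly le_pair_value_iff
proof
  fix i
  let ?c = "coeff (pcompose p [:a, 1:]) i"
  show "w x \<le> w ?c + Fin (nat_mult i \<gamma>)"
  proof (cases "i = 0 \<or> ?c = 0")
    case True
    then show ?thesis using assms(2) by (auto simp: coeff_0_pcompose simp flip: zero_extended_def)
  next
    case False
    have "0 \<le> \<gamma>" using dominant[of 1] by (simp add: zero_extended_def)
    \<comment> \<open>Dominance is applied to a quotient: for \<open>i > 0\<close> one copy of
      \<open>\<gamma>\<close> already outweighs any difference of values of constants.\<close>
    have "w (x / ?c) \<le> Fin \<gamma>"
      using dominant[of "x / ?c"] False assms(1) by (simp add: order.strict_implies_order)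
    also have "Fin \<gamma> \<le> Fin (nat_mult i \<gamma>)" using le_nat_mult[OF \<open>0 \<le> \<gamma>\<close>] False by simp
    finally have "w (x / ?c) + w ?c \<le> Fin (nat_mult i \<gamma>) + w ?c" by (rule extended_add_right_mono)
    then show ?thesis using False by (simp add: add.commute flip: w_mult)
  qed
qed

lemma u_nonroot:
  assumes "poly p a \<noteq> 0"
  shows "u (to_fract p) = w (poly p a)"
proof (rule order.antisym)
  have "u (to_fract p) \<le> w (coeff (pcompose p [:a, 1:]) 0) + Fin (nat_mult 0 \<gamma>)"
    using le_pair_value_iff[of "u (to_fract p)" a \<gamma> p] unfolding u_poly by blast
  then show "u (to_fract p) \<le> w (poly p a)" by (simp add: coeff_0_pcompose flip: zero_extended_def)
qed (use assms le_u_poly in auto)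

lemma u_0: "u 0 = \<infinity>"
  using u_poly[of 0] by (simp add: pair_value_def)

lemma u_power: "u (to_fract (p ^ n)) = nat_mult n (u (to_fract p))"
proof (induction n)
  case 0
  show ?case using u_nonroot[of 1] by simp
qed (simp add: u_mult del: to_fract_mult)

lemma delta_ge:
  assumes "p \<noteq> 0" "poly p c = 0"
  shows "u (to_fract [:- c, 1:]) \<le> delta u p"
proof -
  have eq: "{u (to_fract [:- b, 1:]) | b. poly p b = 0} = (\<lambda>b. u (to_fract [:- b, 1:])) ` {b. poly p b = 0}"
    by auto
  show ?thesis
    unfolding delta_def eq using poly_roots_finite[OF assms(1)] assms(2) by (intro Max_ge) auto
qed

lemma delta_attained:
  assumes "0 < degree p"
  shows "\<exists>b. poly p b = 0 \<and> delta u p = u (to_fract [:- b, 1:])"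
proof -
  have "finite {b. poly p b = 0}" using assms by (intro poly_roots_finite) auto
  moreover have "{b. poly p b = 0} \<noteq> {}" using alg_closed_imp_poly_has_root[OF assms] by auto
  moreover have eq: "{u (to_fract [:- b, 1:]) | b. poly p b = 0} =
      (\<lambda>b. u (to_fract [:- b, 1:])) ` {b. poly p b = 0}"
    by auto
  ultimately have "delta u p \<in> (\<lambda>b. u (to_fract [:- b, 1:])) ` {b. poly p b = 0}"
    unfolding delta_def eq by (intro Max_in) auto
  then show ?thesis by auto
qed

lemma delta_root:
  assumes "p \<noteq> 0" "poly p a = 0"
  shows "delta u p = Fin \<gamma>"
proof (rule order.antisym)
  obtain b where b: "delta u p = u (to_fract [:- b, 1:])"
    using delta_attained[OF degree_pos_if_root[OF assms]] by blast
  show "delta u p \<le> Fin \<gamma>"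
    using dominant[of "a - b"] unfolding b by (simp add: u_linear order.strict_implies_order)
  show "Fin \<gamma> \<le> delta u p" using delta_ge[OF assms] by (simp add: u_linear)
qed

lemma delta_nonroot:
  assumes "0 < degree p" "poly p a \<noteq> 0"
  obtains b where "poly p b = 0" "b \<noteq> a" "delta u p = w (a - b)"
    "\<And>c. poly p c = 0 \<Longrightarrow> w (a - c) \<le> w (a - b)"
proof -
  obtain b where b: "poly p b = 0" "delta u p = u (to_fract [:- b, 1:])"
    using delta_attained[OF assms(1)] by blast
  have ba: "b \<noteq> a" using b(1) assms(2) by auto
  then have d: "delta u p = w (a - b)" using b(2) by (simp add: u_linear)
  have "w (a - c) \<le> w (a - b)" if "poly p c = 0" for c
  proof -
    have "p \<noteq> 0" "c \<noteq> a" using assms that by auto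
    then show ?thesis using delta_ge[of p c] that by (simp add: u_linear d)
  qed
  then show ?thesis using that b(1) ba d by blast
qed

lemma delta_nonroot_less:
  assumes "0 < degree p" "poly p a \<noteq> 0"
  shows "delta u p < Fin \<gamma>"
proof -
  obtain b where "b \<noteq> a" "delta u p = w (a - b)" using delta_nonroot[OF assms] by blast
  then show ?thesis using dominant[of "a - b"] by simp
qed

lemma minimal_polynomial_nonroot:
  "is_minimal_polynomial F a Q \<Longrightarrow> p \<in> polys_over F \<Longrightarrow> p \<noteq> 0 \<Longrightarrow> degree p < degree Q \<Longrightarrow> poly p a \<noteq> 0"
  unfolding is_minimal_polynomial_def using leD by blast

text \<open>Its \<open>delta\<close> is \<open>\<gamma>\<close>, which no polynomial nonzero at
  \<open>a\<close> reaches, and polynomials of smaller degree are nonzero at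
  \<open>a\<close>.\<close>

lemma key_polynomial_minimal:
  assumes "is_minimal_polynomial F a Q"
  shows "key_polynomial F u Q"
proof -
  have Q: "Q \<in> polys_over F" "lead_coeff Q = 1" "poly Q a = 0" "Q \<noteq> 0"
    using assms by (auto simp: is_minimal_polynomial_def)
  have "0 < degree Q" using degree_pos_if_root[OF Q(4,3)] .
  moreover have "delta u f < delta u Q" if "f \<in> polys_over F" "0 < degree f" "degree f < degree Q" for f
  proof -
    have "f \<noteq> 0" using that by auto
    then have "poly f a \<noteq> 0" using minimal_polynomial_nonroot[OF assms that(1) _ that(3)] by blast
    then show ?thesis using delta_root[OF Q(4,3)] delta_nonroot_less[OF that(2)] by simp
  qed
  ultimately show ?thesis using Q by (simp add: key_polynomial_def)
qed

section \<open>Exactness of truncation, at key polynomials and at the minimal polynomial\<close>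

context
  fixes F :: "'l set"
  assumes F: "subfield F (ring_on UNIV)"
begin

context
  fixes Q :: "'l poly"
  assumes key: "key_polynomial F u Q" and Qa: "poly Q a \<noteq> 0"
begin

text \<open>Translates the key property into the distance conditions that the comparison of adic
  terms with coefficients assumes.\<close>

lemma key_polynomial_root:
  obtains d where "d \<noteq> 0" "w d = delta u Q" "poly Q (a + d) = 0"
    "\<And>c. poly Q c = 0 \<Longrightarrow> w (a - c) \<le> w d"
    "\<And>p c. p \<in> polys_over F \<Longrightarrow> p \<noteq> 0 \<Longrightarrow> degree p < degree Q \<Longrightarrow> poly p c = 0 \<Longrightarrow> w (a - c) < w d"
proof -
  obtain b where b: "poly Q b = 0" "b \<noteq> a" "delta u Q = w (a - b)"
    "\<And>c. poly Q c = 0 \<Longrightarrow> w (a - c) \<le> w (a - b)"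
    using delta_nonroot[OF _ Qa] key unfolding key_polynomial_def by blast
  show ?thesis
  proof (rule that[of "b - a"])
    show "w (b - a) = delta u Q" using b(3) by (simp add: w_diff_commute)
    show "w (a - c) \<le> w (b - a)" if "poly Q c = 0" for c using b(4)[OF that] by (simp add: w_diff_commute)
    fix p c assume p: "p \<in> polys_over F" "p \<noteq> 0" "degree p < degree Q" "poly p c = 0"
    have "0 < degree p" using degree_pos_if_root[OF p(2,4)] .
    then have "delta u p < w (a - b)" using key p b(3) by (simp add: key_polynomial_def)
    then have less: "u (to_fract [:- c, 1:]) < w (a - b)"
      using delta_ge[OF p(2,4)] by (rule order.strict_trans1[rotated])
    \<comment> \<open>Excludes \<open>c = a\<close>, where \<open>X - c\<close> would have value
      \<open>\<gamma>\<close> instead of \<open>w (a - c)\<close>.\<close>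
    also have "w (a - b) < Fin \<gamma>" using b(2) by (intro dominant) simp
    finally show "w (a - c) < w (b - a)"
      using less by (auto simp: u_linear w_diff_commute[of a b] split: if_splits)
  qed (use b in auto)
qed

lemma key_polynomial_small_nonroot:
  assumes "p \<in> polys_over F" "p \<noteq> 0" "degree p < degree Q"
  shows "poly p a \<noteq> 0"
proof (rule key_polynomial_root)
  fix d assume "\<And>p c. p \<in> polys_over F \<Longrightarrow> p \<noteq> 0 \<Longrightarrow> degree p < degree Q \<Longrightarrow> poly p c = 0 \<Longrightarrow>
    w (a - c) < w d"
  from this[OF assms, of a] show ?thesis by auto
qed

lemma truncation_term:
  assumes "f \<in> polys_over F"
  shows "u (to_fract (adic_coeff Q f i)) + nat_mult i (u (to_fract Q)) =
    w (poly (adic_coeff Q f i) a * poly Q a ^ i)"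
proof -
  have Q: "Q \<in> polys_over F" "lead_coeff Q = 1" "0 < degree Q" using key by (auto simp: key_polynomial_def)
  let ?p = "adic_coeff Q f i"
  have "u (to_fract ?p) = w (poly ?p a)"
  proof (cases "?p = 0")
    case False
    have "?p \<in> polys_over F" using polys_over_adic_coeff[OF F assms] Q by simp
    moreover have "degree ?p < degree Q" using Q(3) by (simp add: adic_coeff_def degree_mod_less_pos)
    ultimately have "poly ?p a \<noteq> 0" using key_polynomial_small_nonroot False by blast
    then show ?thesis by (rule u_nonroot)
  qed (simp add: u_0)
  then show ?thesis by (simp add: w_mult w_power u_nonroot[OF Qa])
qed

lemma le_truncation_iff:
  assumes "f \<in> polys_over F"
  shows "t \<le> truncation u Q f \<longleftrightarrow> (\<forall>i. t \<le> w (poly (adic_coeff Q f i) a * poly Q a ^ i))"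
proof -
  have "0 < degree Q" using key by (simp add: key_polynomial_def)
  then have "adic_coeff Q f i = 0" if "degree f < i" for i using that by (rule adic_coeff_eq_0)
  then have "t \<le> w (poly (adic_coeff Q f i) a * poly Q a ^ i)" if "degree f < i" for i using that by simp
  then have "(\<forall>i. t \<le> w (poly (adic_coeff Q f i) a * poly Q a ^ i)) \<longleftrightarrow>
      (\<forall>i\<in>{..degree f}. t \<le> w (poly (adic_coeff Q f i) a * poly Q a ^ i))"
    by (meson atMost_iff not_le)
  then show ?thesis unfolding truncation_def truncation_term[OF assms] by (subst Min_ge_iff) auto
qed

text \<open>The adic terms at \<open>a\<close> sum to \<open>poly f a\<close>, so they cannot all
  have larger value.\<close>

lemma truncation_le:
  assumes "f \<in> polys_over F" "poly f a \<noteq> 0"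
  shows "truncation u Q f \<le> w (poly f a)"
proof (rule ccontr)
  assume "\<not> ?thesis"
  then have gt: "w (poly f a) < truncation u Q f" by simp
  have Q: "0 < degree Q" using key by (simp add: key_polynomial_def)
  have "truncation u Q f \<le> w (poly (adic_coeff Q f i) a * poly Q a ^ i)" for i
    using le_truncation_iff[OF assms(1), of "truncation u Q f"] by blast
  then have "w (poly f a) < w (\<Sum>i\<le>degree f. poly (adic_coeff Q f i) a * poly Q a ^ i)"
    using assms(2) by (intro w_sum_gt w_less_Pinf order.strict_trans2[OF gt])
  also have "(\<Sum>i\<le>degree f. poly (adic_coeff Q f i) a * poly Q a ^ i) = poly f a"
    using arg_cong[OF adic_expansion[OF Q, of f], of "\<lambda>p. poly p a"] by (simp add: poly_sum)
  finally show False by simp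
qed

text \<open>The right-hand side retains nothing of \<open>Q\<close> but \<open>delta u Q\<close>,
  which is what allows one precision for all \<open>Q\<close>.\<close>

lemma truncation_eq_iff:
  assumes "f \<in> polys_over F" "poly f a \<noteq> 0" "w d = delta u Q"
  shows "u (to_fract f) = truncation u Q f \<longleftrightarrow> coeffs_ge (poly f a) (pcompose f [:a, d:])"
proof (rule key_polynomial_root)
  have Q: "Q \<in> polys_over F" "lead_coeff Q = 1" "0 < degree Q" using key by (auto simp: key_polynomial_def)
  fix d' assume d': "w d' = delta u Q" "poly Q (a + d') = 0"
    "\<And>c. poly Q c = 0 \<Longrightarrow> w (a - c) \<le> w d'"
    "\<And>p c. p \<in> polys_over F \<Longrightarrow> p \<noteq> 0 \<Longrightarrow> degree p < degree Q \<Longrightarrow> poly p c = 0 \<Longrightarrow> w (a - c) < w d'"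
  have "u (to_fract f) = truncation u Q f \<longleftrightarrow> w (poly f a) \<le> truncation u Q f"
    using truncation_le[OF assms(1,2)] by (auto simp: u_nonroot[OF assms(2)])
  also have "\<dots> \<longleftrightarrow> coeffs_ge (poly f a) (pcompose f [:a, d':])"
    unfolding le_truncation_iff[OF assms(1)]
    using w_adic_term_ge[OF F Q d'(2-4) assms(1), where s = "poly f a" and e = 1]
      coeffs_ge_pcompose_adic[OF F Q d'(2-4) assms(1), where s = "poly f a"] by auto
  also have "\<dots> \<longleftrightarrow> coeffs_ge (poly f a) (pcompose f [:a, d:])"
    using assms(3) d'(1) by (auto intro: coeffs_ge_pcompose_mono)
  finally show ?thesis .
qed

end

text \<open>The lowest nonzero adic term has exactly the value of \<open>f\<close>, and every later
  term has at least one more factor \<open>Q\<close>, whose value outweighs that of any nonzero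
  constant.\<close>

lemma truncation_minimal_polynomial:
  assumes Q: "is_minimal_polynomial F a Q" and f: "f \<in> polys_over F" "f \<noteq> 0"
  shows "u (to_fract f) = truncation u Q f"
proof -
  have Q': "Q \<in> polys_over F" "lead_coeff Q = 1" "poly Q a = 0" "Q \<noteq> 0"
    using Q by (auto simp: is_minimal_polynomial_def)
  have dQ: "0 < degree Q" using degree_pos_if_root[OF Q'(4,3)] .
  have nz: "poly (adic_coeff Q f i) a \<noteq> 0" if "adic_coeff Q f i \<noteq> 0" for i
  proof -
    have "adic_coeff Q f i \<in> polys_over F" using polys_over_adic_coeff[OF F f(1)] Q' by simp
    moreover have "degree (adic_coeff Q f i) < degree Q" using dQ by (simp add: adic_coeff_def degree_mod_less_pos)
    ultimately show ?thesis using minimal_polynomial_nonroot[OF Q] that by blast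
  qed
  \<comment> \<open>\<open>i0\<close> is the multiplicity of \<open>Q\<close> in \<open>f\<close>;
    the cofactor \<open>f div Q ^ i0\<close> is nonzero at \<open>a\<close>.\<close>
  define i0 where "i0 = (LEAST i. adic_coeff Q f i \<noteq> 0)"
  have "\<exists>i. adic_coeff Q f i \<noteq> 0"
  proof (rule ccontr)
    assume "\<not> ?thesis"
    then have "(\<Sum>i\<le>degree f. adic_coeff Q f i * Q ^ i) = 0" by simp
    then show False using adic_expansion[OF dQ, of f] f(2) by simp
  qed
  then have i0: "adic_coeff Q f i0 \<noteq> 0" and least: "\<And>i. i < i0 \<Longrightarrow> adic_coeff Q f i = 0"
    unfolding i0_def by (rule LeastI_ex) (use not_less_Least in blast)
  define x where "x = poly (adic_coeff Q f i0) a"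
  have x: "x \<noteq> 0" using nz[OF i0] by (simp add: x_def)
  have "f = Q ^ i * (f div Q ^ i)" if "i \<le> i0" for i
    using that
  proof (induction i)
    case (Suc i)
    have "f div Q ^ i = f div Q ^ i div Q * Q + adic_coeff Q f i" by (simp add: adic_coeff_def)
    also have "\<dots> = f div Q ^ Suc i * Q"
      using least[of i] Suc.prems by (simp only: power_Suc2 poly_div_mult_right) simp
    finally show ?case using Suc by (simp add: mult_ac)
  qed simp
  then have f_eq: "f = Q ^ i0 * (f div Q ^ i0)" by simp
  have "f div Q ^ i0 = f div Q ^ i0 div Q * Q + adic_coeff Q f i0" by (simp add: adic_coeff_def)
  from arg_cong[OF this, of "\<lambda>p. poly p a"] have "poly (f div Q ^ i0) a = x"
    using Q'(3) by (simp add: x_def)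
  then have uf: "u (to_fract f) = w x + nat_mult i0 (u (to_fract Q))"
    using u_nonroot[of "f div Q ^ i0"] x by (subst f_eq) (simp add: u_mult u_power add.commute del: to_fract_mult)
  let ?t = "\<lambda>i. u (to_fract (adic_coeff Q f i)) + nat_mult i (u (to_fract Q))"
  have t0: "?t i0 = u (to_fract f)" using u_nonroot[OF nz[OF i0]] uf by (simp add: x_def)
  have ge: "u (to_fract f) \<le> ?t i" for i
  proof (cases "adic_coeff Q f i = 0")
    case True
    then show ?thesis by (cases "nat_mult i (u (to_fract Q))") (simp_all add: u_0)
  next
    case False
    define y where "y = poly (adic_coeff Q f i) a"
    have y: "y \<noteq> 0" using nz[OF False] by (simp add: y_def)
    have "i0 \<le> i" using least False by (meson not_less)
    then obtain k where k: "i = i0 + k" using le_Suc_ex by blast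
    have uQ: "w z \<le> u (to_fract Q)" if "z \<noteq> 0" for z using that Q'(3) by (intro le_u_poly) auto
    have "w x \<le> w y + nat_mult k (u (to_fract Q))"
    proof (cases k)
      case 0
      then have "i = i0" using k by simp
      then show ?thesis using 0 by (simp add: x_def y_def)
    next
      case (Suc l)
      have "0 \<le> nat_mult l (u (to_fract Q))"
      proof (induction l)
        case (Suc l)
        then show ?case using add_mono[OF uQ[of 1], of 0] by simp
      qed simp
      \<comment> \<open>The first of the \<open>k = Suc l\<close> copies of
        \<open>u (to_fract Q)\<close> pays for \<open>w (x / y)\<close>; the others are
        nonnegative.\<close>
      then have "w (x / y) + 0 \<le> u (to_fract Q) + nat_mult l (u (to_fract Q))"
        using x y by (intro add_mono uQ) auto
      then have "w y + w (x / y) \<le> w y + nat_mult k (u (to_fract Q))"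
        using Suc by (intro add_mono) simp_all
      then show ?thesis using y by (simp flip: w_mult)
    qed
    then have "w x + nat_mult i0 (u (to_fract Q)) \<le> w y + nat_mult k (u (to_fract Q)) + nat_mult i0 (u (to_fract Q))"
      by (rule add_mono) simp
    then show ?thesis using u_nonroot[OF nz[OF False]] by (simp add: uf k y_def nat_mult_add add_ac)
  qed
  have "i0 \<le> degree f" using adic_coeff_eq_0[OF dQ, of f i0] i0 by (meson not_less)
  then have "truncation u Q f = u (to_fract f)"
    unfolding truncation_def using ge t0 by (intro Min_eqI) (auto intro!: rev_image_eqI)
  then show ?thesis ..
qed

end

end

section \<open>Passing to the completion\<close>

text \<open>Injectivity of \<open>\<delta>\<close> gives totality, and the other order axioms come
  from \<open><\<close>; only well-foundedness remains to be transported.\<close>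

lemma well_order_on_less_iff_wf:
  fixes \<delta> :: "'a \<Rightarrow> 'b::linorder"
  assumes "inj_on \<delta> S"
  shows "well_order_on S {(x, y). x \<in> S \<and> y \<in> S \<and> (x = y \<or> \<delta> x < \<delta> y)} \<longleftrightarrow>
    wf {(x, y). x \<in> S \<and> y \<in> S \<and> \<delta> x < \<delta> y}"
proof -
  let ?r = "{(x, y). x \<in> S \<and> y \<in> S \<and> (x = y \<or> \<delta> x < \<delta> y)}"
  have "?r - Id = {(x, y). x \<in> S \<and> y \<in> S \<and> \<delta> x < \<delta> y}" by auto
  moreover have "trans ?r" by (auto intro!: transI)
  moreover have "antisym ?r" by (auto intro!: antisymI)
  moreover have "total_on S ?r"
    using assms by (auto simp: total_on_def inj_on_def) (meson linorder_neqE)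
  moreover have "refl_on S ?r" by (auto simp: refl_on_def)
  moreover have "?r \<subseteq> S \<times> S" by auto
  ultimately show ?thesis
    by (auto simp: well_order_on_def linear_order_on_def partial_order_on_def preorder_on_def)
qed

text \<open>\<open>L\<close> and \<open>u\<close> stand for the completion and its induced
  valuation. Agreement of \<open>delta\<close> is a separate assumption because it involves
  \<open>X - b\<close> for roots \<open>b\<close> outside \<open>K\<close>.\<close>

locale dense_dominant_pair = dominant_pair w a \<gamma> u
  for w :: "'l::alg_closed_field \<Rightarrow> 'g::linordered_ab_group_add extended" and a \<gamma> u +
  fixes K L :: "'l set" and v :: "'l poly fract \<Rightarrow> 'g extended"
  assumes K: "subfield K (ring_on UNIV)" and L: "subfield L (ring_on UNIV)" and K_le_L: "K \<subseteq> L"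
    and dense: "x \<in> L \<Longrightarrow> e \<noteq> 0 \<Longrightarrow> \<exists>y\<in>K. w e < w (x - y)"
    and v_eq: "p \<in> polys_over K \<Longrightarrow> v (to_fract p) = u (to_fract p)"
    and delta_eq: "p \<in> polys_over K \<Longrightarrow> 0 < degree p \<Longrightarrow> delta v p = delta u p"
begin

lemma polys_over_mono: "p \<in> polys_over K \<Longrightarrow> p \<in> polys_over L"
  using K_le_L by (auto simp: polys_over_def)

lemma truncation_eq:
  "f \<in> polys_over K \<Longrightarrow> Q \<in> polys_over K \<Longrightarrow> lead_coeff Q = 1 \<Longrightarrow> truncation v Q f = truncation u Q f"
  by (simp add: truncation_def v_eq polys_over_adic_coeff[OF K])

context
  fixes Qmin :: "'l poly"
  assumes Qmin: "is_minimal_polynomial L a Qmin"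
begin

text \<open>A smaller \<open>f\<close> over \<open>L\<close> is matched by some \<open>g\<close>
  over \<open>K\<close> of equal degree with \<open>delta u f \<le> delta u g\<close>, and the key
  property over \<open>K\<close> applies to \<open>g\<close>.\<close>

lemma key_polynomial_lift:
  assumes key: "key_polynomial K v Q" and deg: "degree Q \<le> degree Qmin"
  shows "key_polynomial L u Q"
  unfolding key_polynomial_def
proof (intro conjI ballI impI)
  have Q: "Q \<in> polys_over K" "0 < degree Q" "lead_coeff Q = 1" using key by (auto simp: key_polynomial_def)
  then show "Q \<in> polys_over L" "0 < degree Q" "lead_coeff Q = 1" by (auto intro: polys_over_mono)
  fix f assume f: "f \<in> polys_over L" "0 < degree f \<and> degree f < degree Q"
  then have f0: "f \<noteq> 0" by auto
  have "poly f a \<noteq> 0" using minimal_polynomial_nonroot[OF Qmin f(1) f0] f(2) deg by simp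
  then obtain b where b: "poly f b = 0" "b \<noteq> a" "delta u f = w (a - b)"
    using delta_nonroot[of f] f(2) by blast
  then have "a - b \<noteq> 0" by simp
  then obtain g c where g: "g \<in> polys_over K" "degree g = degree f" "poly g c = 0"
      and bc: "w (a - b) < w (b - c)"
    using approx_root[OF K dense f(1) f0 b(1)] by blast
  \<comment> \<open>The precision \<open>a - b\<close> was chosen for this: \<open>c\<close> is
    closer to \<open>b\<close> than \<open>a\<close> is, so it lies as far from \<open>a\<close> as
    \<open>b\<close>.\<close>
  have "w (a - c) = w (a - b)" using w_add_eq[OF bc] by simp
  moreover have "c \<noteq> a" using bc by (auto simp: w_diff_commute[of a b])
  ultimately have "delta u f = u (to_fract [:- c, 1:])" using b(3) by (simp add: u_linear)
  also have "\<dots> \<le> delta u g" using g f(2) by (intro delta_ge) auto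
  also have "\<dots> = delta v g" using g f(2) by (simp add: delta_eq)
  also have "\<dots> < delta v Q" using key g f(2) by (simp add: key_polynomial_def)
  also have "\<dots> = delta u Q" using Q by (simp add: delta_eq)
  finally show "delta u f < delta u Q" .
qed

section \<open>Transfer of a complete sequence from \<open>K\<close> to \<open>L\<close>\<close>

context
  fixes S :: "'l poly set"
  assumes seq: "complete_sequence K v S"
begin

lemma key_of_seq: "Q \<in> S \<Longrightarrow> key_polynomial K v Q"
  using seq by (simp add: complete_sequence_def)

lemma inj_delta_of_seq: "inj_on (delta v) S"
  using seq unfolding complete_sequence_def by (meson inj_onI)

lemma wf_delta_of_seq: "wf {(Q, Q'). Q \<in> S \<and> Q' \<in> S \<and> delta v Q < delta v Q'}"
  using seq unfolding complete_sequence_def well_order_on_less_iff_wf[OF inj_delta_of_seq] by blast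

text \<open>The well order has a least member \<open>P\<close>. If \<open>P\<close> vanishes at
  \<open>a\<close>, its \<open>delta\<close> is \<open>\<gamma>\<close> and \<open>d = 1\<close>
  lies below it by dominance.\<close>

lemma ex_delta_lower_bound: "\<exists>d. d \<noteq> 0 \<and> (\<forall>Q\<in>S. w d \<le> delta u Q)"
proof (cases "S = {}")
  case False
  have "\<exists>P\<in>S. \<forall>Q\<in>S. \<not> delta v Q < delta v P"
  proof (rule wfE_min'[OF wf_delta_of_seq False])
    fix P assume "P \<in> S"
      and "\<And>Q. (Q, P) \<in> {(Q, Q'). Q \<in> S \<and> Q' \<in> S \<and> delta v Q < delta v Q'} \<Longrightarrow> Q \<notin> S"
    then show ?thesis by blast
  qed
  then obtain P where P: "P \<in> S" "\<And>Q. Q \<in> S \<Longrightarrow> \<not> delta v Q < delta v P" by blast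
  have degP: "0 < degree P" using key_of_seq[OF P(1)] by (simp add: key_polynomial_def)
  have deltas: "delta v Q = delta u Q" if "Q \<in> S" for Q
    using key_of_seq[OF that] unfolding key_polynomial_def by (blast intro: delta_eq)
  have "\<exists>d. d \<noteq> 0 \<and> w d \<le> delta u P"
  proof (cases "poly P a = 0")
    case True
    moreover have "P \<noteq> 0" using degP by auto
    ultimately have "delta u P = Fin \<gamma>" by (intro delta_root)
    then show ?thesis using less_imp_le[OF dominant[of 1]] by (intro exI[of _ 1]) simp
  next
    case False
    obtain b where "b \<noteq> a" "delta u P = w (a - b)" using delta_nonroot[OF degP False] by blast
    then show ?thesis by (intro exI[of _ "a - b"]) simp
  qed
  then obtain d where d: "d \<noteq> 0" "w d \<le> delta u P" by blast
  have "w d \<le> delta u Q" if "Q \<in> S" for Q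
    using d(2) leI[OF P(2)[OF that]] unfolding deltas[OF that] deltas[OF P(1)] by (rule order.trans)
  then show ?thesis using d(1) by blast
qed (auto intro: exI[of _ 1])

lemma truncation_from_seq:
  assumes f: "f \<in> polys_over L" "0 < degree f" "degree f < degree Qmin"
  shows "\<exists>Q\<in>S. degree Q \<le> degree f \<and> u (to_fract f) = truncation u Q f"
proof -
  have f0: "f \<noteq> 0" using f by auto
  have fa: "poly f a \<noteq> 0" using minimal_polynomial_nonroot[OF Qmin f(1) f0 f(3)] .
  obtain d0 where d0: "d0 \<noteq> 0" "\<And>Q. Q \<in> S \<Longrightarrow> w d0 \<le> delta u Q" using ex_delta_lower_bound by blast
  \<comment> \<open>The precision is measured at the uniform radius \<open>d0\<close>, because
    \<open>Q\<close> is known only after \<open>g\<close> has been chosen.\<close>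
  obtain e where e: "e \<noteq> 0" "\<And>h j. degree h \<le> degree f \<Longrightarrow> (\<forall>i. w e < w (coeff h i)) \<Longrightarrow>
      w (poly f a) < w (coeff (pcompose h [:a, d0:]) j)"
    using ex_perturbation_bound[OF fa, of "degree f" "[:a, d0:]"] by blast
  obtain g where g: "g \<in> polys_over K" "degree g = degree f" "\<And>i. w e < w (coeff (f - g) i)"
    using approx_poly[OF K dense f(1) f0 e(1)] by blast
  obtain Q where Q: "Q \<in> S" "degree Q \<le> degree g" "v (to_fract g) = truncation v Q g"
    using seq g(1,2) f(2) unfolding complete_sequence_def by (elim conjE) metis
  note keyK = key_of_seq[OF Q(1)]
  have QK: "Q \<in> polys_over K" "lead_coeff Q = 1" "Q \<noteq> 0" using keyK by (auto simp: key_polynomial_def)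
  have degQ: "degree Q < degree Qmin" using Q(2) g(2) f(3) by simp
  have Qa: "poly Q a \<noteq> 0" using minimal_polynomial_nonroot[OF Qmin polys_over_mono[OF QK(1)] QK(3) degQ] .
  have key: "key_polynomial L u Q" using key_polynomial_lift[OF keyK] degQ by simp
  have gL: "g \<in> polys_over L" using polys_over_mono[OF g(1)] .
  have "g \<noteq> 0" using g(2) f(2) by auto
  then have ga: "poly g a \<noteq> 0" using minimal_polynomial_nonroot[OF Qmin gL] g(2) f(3) by simp
  have "0 < degree Q" using keyK by (simp add: key_polynomial_def)
  then obtain b where "delta u Q = w (a - b)" using delta_nonroot[OF _ Qa] by blast
  then obtain d where d: "w d = delta u Q" by metis
  have "degree (f - g) \<le> degree f" using g(2) by (intro degree_diff_le) auto
  then have close: "w (poly f a) < w (coeff (pcompose (f - g) [:a, d0:]) j)" for j using e(2) g(3) by blast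
  then have "coeffs_ge (poly f a) (pcompose (f - g) [:a, d0:])"
    unfolding coeffs_ge_def by (blast intro: less_imp_le)
  \<comment> \<open>Passing from \<open>d0\<close> to \<open>d\<close> only raises the values of the
    coefficients, so the bound on the error persists at the radius belonging to
    \<open>Q\<close>.\<close>
  then have diff: "coeffs_ge (poly f a) (pcompose (f - g) [:a, d:])"
    by (rule coeffs_ge_pcompose_mono) (use d0(2)[OF Q(1)] d in simp)
  have "u (to_fract g) = truncation u Q g" using Q(3) g(1) QK by (simp add: v_eq truncation_eq)
  then have "coeffs_ge (poly g a) (pcompose g [:a, d:])" using truncation_eq_iff[OF L key Qa gL ga d] by simp
  moreover have "w (poly f a) \<le> w (poly g a)"
  proof -
    have "w (poly f a) \<le> w (poly f a - poly (f - g) a)"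
      using less_imp_le[OF close[of 0]] by (intro w_diff_ge) (simp_all add: coeff_0_pcompose)
    then show ?thesis by simp
  qed
  ultimately have "coeffs_ge (poly f a) (pcompose g [:a, d:])" by (rule coeffs_ge_trans[rotated])
  then have "coeffs_ge (poly f a) (pcompose (f - g) [:a, d:] + pcompose g [:a, d:])"
    using diff by (intro coeffs_ge_add)
  then have "coeffs_ge (poly f a) (pcompose f [:a, d:])" by (simp add: pcompose_diff)
  then have "u (to_fract f) = truncation u Q f" using truncation_eq_iff[OF L key Qa f(1) fa d] by simp
  then show ?thesis using Q(1,2) g(2) by auto
qed

end

lemma complete_sequence_lift:
  assumes seq: "complete_sequence K v (S \<union> {Qa})" and Qa: "is_minimal_polynomial K a Qa" "Qa \<notin> S"
  shows "complete_sequence L u ({Q \<in> S. degree Q \<le> degree Qmin} \<union> {Qmin})"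
proof -
  let ?S = "{Q \<in> S. degree Q \<le> degree Qmin} \<union> {Qmin}"
  \<comment> \<open>\<open>Qmin\<close> takes the place of \<open>Qa\<close>. Both have
    \<open>delta\<close> equal to \<open>\<gamma>\<close>, so \<open>m\<close> preserves
    \<open>delta\<close> and the well order can be pulled back along it.\<close>
  define m where "m = (\<lambda>Q. if Q = Qmin then Qa else Q)"
  have Qa': "Qa \<in> polys_over K" "poly Qa a = 0" "Qa \<noteq> 0"
    using Qa by (auto simp: is_minimal_polynomial_def)
  have Qmin': "poly Qmin a = 0" "Qmin \<noteq> 0" "Qmin \<in> polys_over L"
    using Qmin by (auto simp: is_minimal_polynomial_def)
  note inj = inj_delta_of_seq[OF seq]
  have delta_Qa: "delta v Qa = Fin \<gamma>"
    using delta_eq[OF Qa'(1) degree_pos_if_root[OF Qa'(3,2)]] delta_root[OF Qa'(3,2)] by simp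
  have key: "key_polynomial K v Q" if "Q \<in> S" for Q using key_of_seq[OF seq] that by simp
  have m_in: "m Q \<in> S \<union> {Qa}" if "Q \<in> ?S" for Q using that by (auto simp: m_def)
  have m_delta: "delta u Q = delta v (m Q)" if "Q \<in> ?S" for Q
  proof (cases "Q = Qmin")
    case True
    then show ?thesis using delta_root[OF Qmin'(2,1)] delta_Qa by (simp add: m_def)
  next
    case False
    then have "Q \<in> polys_over K" "0 < degree Q" using key[of Q] that by (simp_all add: key_polynomial_def)
    then show ?thesis using False by (simp add: m_def delta_eq)
  qed
  have inj_m: "inj_on m ?S" using Qa(2) by (auto simp: inj_on_def m_def)
  have inj': "inj_on (delta u) ?S"
  proof (intro inj_onI)
    fix P P' assume P: "P \<in> ?S" "P' \<in> ?S" "delta u P = delta u P'"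
    then have "delta v (m P) = delta v (m P')" by (simp only: m_delta)
    then have "m P = m P'" using inj m_in P by (blast dest: inj_onD)
    then show "P = P'" using inj_m P by (blast dest: inj_onD)
  qed
  have "wf (inv_image {(Q, Q'). Q \<in> S \<union> {Qa} \<and> Q' \<in> S \<union> {Qa} \<and> delta v Q < delta v Q'} m)"
    using wf_delta_of_seq[OF seq] by (rule wf_inv_image)
  then have wf: "wf {(Q, Q'). Q \<in> ?S \<and> Q' \<in> ?S \<and> delta u Q < delta u Q'}"
  proof (rule wf_subset, intro subsetI)
    fix x assume "x \<in> {(Q, Q'). Q \<in> ?S \<and> Q' \<in> ?S \<and> delta u Q < delta u Q'}"
    then obtain P P' where "x = (P, P')" "P \<in> ?S" "P' \<in> ?S" "delta u P < delta u P'" by blast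
    then show "x \<in> inv_image {(Q, Q'). Q \<in> S \<union> {Qa} \<and> Q' \<in> S \<union> {Qa} \<and> delta v Q < delta v Q'} m"
      using m_in m_delta by (simp only: in_inv_image mem_Collect_eq prod.case)
  qed
  show ?thesis
    unfolding complete_sequence_def
  proof (intro conjI)
    show "\<forall>Q\<in>?S. key_polynomial L u Q"
    proof
      fix P assume "P \<in> ?S"
      then consider "P = Qmin" | "P \<in> S" "degree P \<le> degree Qmin" by blast
      then show "key_polynomial L u P"
        by cases (simp_all add: key_polynomial_lift key key_polynomial_minimal[OF Qmin])
    qed
    show "\<forall>Q\<in>?S. \<forall>Q'\<in>?S. Q \<noteq> Q' \<longrightarrow> delta u Q \<noteq> delta u Q'"
      using inj' unfolding inj_on_def by blast
    show "well_order_on ?S {(Q, Q'). Q \<in> ?S \<and> Q' \<in> ?S \<and> (Q = Q' \<or> delta u Q < delta u Q')}"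
      using wf by (simp only: well_order_on_less_iff_wf[OF inj'])
    show "\<forall>f\<in>polys_over L. 0 < degree f \<longrightarrow>
        (\<exists>Q\<in>?S. degree Q \<le> degree f \<and> u (to_fract f) = truncation u Q f)"
    proof (intro ballI impI)
      fix f assume f: "f \<in> polys_over L" "0 < degree f"
      show "\<exists>Q\<in>?S. degree Q \<le> degree f \<and> u (to_fract f) = truncation u Q f"
      proof (cases "degree f < degree Qmin")
        case True
        then obtain Q where Q: "Q \<in> S \<union> {Qa}" "degree Q \<le> degree f" "u (to_fract f) = truncation u Q f"
          using truncation_from_seq[OF seq f] by blast
        \<comment> \<open>\<open>Qa\<close> also lies over \<open>L\<close> and vanishes at
          \<open>a\<close>; so in degrees below that of \<open>Qmin\<close> the exact member cannot
          be \<open>Qa\<close>.\<close>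
        have "degree Qmin \<le> degree Qa"
          using minimal_polynomial_nonroot[OF Qmin polys_over_mono[OF Qa'(1)] Qa'(3)] Qa'(2) leI by blast
        then have "Q \<noteq> Qa" using Q(2) True by auto
        then show ?thesis using Q True by auto
      next
        case False
        have "f \<noteq> 0" using f by auto
        then have "u (to_fract f) = truncation u Qmin f"
          by (rule truncation_minimal_polynomial[OF L Qmin f(1)])
        then show ?thesis using False by auto
      qed
    qed
  qed
qed

end

end

lemma pair_value_cong:
  assumes F: "subfield F (ring_on UNIV)" and "p \<in> polys_over F" "a \<in> F" and "\<And>c. c \<in> F \<Longrightarrow> w c = w' c"
  shows "pair_value w a \<gamma> p = pair_value w' a \<gamma> p"
proof -
  have "[:a, 1:] \<in> polys_over F"
    using assms(3) subfield_ring_on_closed[OF F] polys_over_0[OF F] by (simp add: polys_over_pCons_iff[OF F])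
  then have "pcompose p [:a, 1:] \<in> polys_over F" using polys_over_pcompose[OF F assms(2)] by simp
  then show ?thesis using assms(4) by (simp add: pair_value_def polys_over_def)
qed

text \<open>If \<open>w c \<ge> \<gamma>\<close> with \<open>c \<noteq> 0\<close>, then \<open>(a + c, \<gamma>)\<close> is a second pair of definition.\<close>
lemma (in alg_closed_valuation) unique_pair_dominant:
  assumes F: "subfield (alg_clos F) (ring_on UNIV)"
    and pair: "is_pair_of_definition F v a \<gamma>"
    and unique: "\<And>a'. is_pair_of_definition F v a' \<gamma> \<Longrightarrow> a' = a"
    and w_eq: "\<And>c. c \<in> alg_clos F \<Longrightarrow> w c = v (to_fract [:c:])"
    and c: "c \<in> alg_clos F" "c \<noteq> 0"
  shows "w c < Fin \<gamma>"
proof (rule ccontr)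
  assume "\<not> ?thesis"
  then have ge: "Fin \<gamma> \<le> w c" by simp
  have a: "a \<in> alg_clos F" using pair by (simp add: is_pair_of_definition_def)
  then have ac: "a + c \<in> alg_clos F" using c(1) subfield_ring_on_closed(3)[OF F] by simp
  have "v (to_fract p) = pair_value (\<lambda>c. v (to_fract [:c:])) (a + c) \<gamma> p"
    if p: "p \<in> polys_over (alg_clos F)" for p
  proof -
    have "v (to_fract p) = pair_value (\<lambda>c. v (to_fract [:c:])) a \<gamma> p"
      using pair p by (simp add: is_pair_of_definition_def is_pair_valuation_def)
    also have "\<dots> = pair_value w a \<gamma> p" using pair_value_cong[OF F p a] w_eq by metis
    also have "\<dots> = pair_value w (a + c) \<gamma> p" using pair_value_shift[OF ge] by simp
    also have "\<dots> = pair_value (\<lambda>c. v (to_fract [:c:])) (a + c) \<gamma> p"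
      using pair_value_cong[OF F p ac] w_eq by metis
    finally show ?thesis .
  qed
  then have "is_pair_of_definition F v (a + c) \<gamma>"
    using pair ac by (simp add: is_pair_of_definition_def is_pair_valuation_def)
  from unique[OF this] show False using c(2) by simp
qed

lemma dense_in_ring_on:
  fixes L :: "'l::field set"
  assumes L: "Ring.field (ring_on L)" and "K \<subseteq> L" "dense_in K (ring_on L) w" "x \<in> L" "c \<in> L" "w c = Fin g"
  shows "\<exists>y\<in>K. w c < w (x - y)"
proof -
  interpret Ring.field "ring_on L" by (rule L)
  have "g \<in> value_group (ring_on L) w" using assms(5,6) by (auto simp: value_group_def)
  then obtain y where y: "y \<in> K" "Fin g < w (x \<ominus>\<^bsub>ring_on L\<^esub> y)"
    using assms(3,4) unfolding dense_in_def by auto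
  have "y \<in> L" "- y \<in> L" using y(1) assms(2) subfield_ring_on_closed(4)[OF subfield_ring_on[OF L]] by auto
  then have "\<ominus>\<^bsub>ring_on L\<^esub> y = - y" by (intro minus_equality) simp_all
  then show ?thesis using y assms(6) by (auto simp: a_minus_def)
qed

theorem theorem3p4:
  fixes K Khat :: "'l::alg_closed_field set"
    and v vhat :: "'l poly fract \<Rightarrow> 'g::linordered_ab_group_add extended"
    and w :: "'l \<Rightarrow> 'g extended"
    and a :: 'l and \<gamma> :: 'g
    and \<Lambda> :: "'i set" and Q :: "'i \<Rightarrow> 'l poly" and Qa Qa_hat :: "'l poly"
  assumes K: "Ring.field (ring_on K)"
    and v: "valued_field (ring_on (ratfuns_over (alg_clos K))) v"
    and vtr: "value_transcendental K v"
    and pair: "is_pair_of_definition K v a \<gamma>"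
    and pair_unique: "\<forall>a' \<gamma>'. is_pair_of_definition K v a' \<gamma>' \<longrightarrow> a' = a \<and> \<gamma>' = \<gamma>"
    and closure: "alg_clos Khat = UNIV"
    and w: "valued_field (ring_on UNIV) w"
    and w_extends: "\<forall>c\<in>alg_clos K. w c = v (to_fract [:c:])"
    and completion: "is_completion K Khat w"
    and Qa: "is_minimal_polynomial K a Qa"
    and seq: "complete_sequence K v (Q ` \<Lambda> \<union> {Qa})"
    and remaining: "\<forall>\<nu>\<in>\<Lambda>. Q \<nu> \<noteq> Qa"
    and vhat: "is_pair_valuation Khat w a \<gamma> vhat"
    and Qa_hat: "is_minimal_polynomial Khat a Qa_hat"
  shows "complete_sequence Khat vhat (Q ` {\<nu>\<in>\<Lambda>. degree (Q \<nu>) \<le> degree Qa_hat} \<union> {Qa_hat})"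
proof -
  interpret alg_closed_valuation w
    by (intro alg_closed_valuation.intro field_valuation.intro w)
  have Khat: "Ring.field (ring_on Khat)"
    using completion by (simp add: is_completion_def valued_field_def)
  have sub: "K \<subseteq> Khat" and dns: "dense_in K (ring_on Khat) w" using completion by (auto simp: is_completion_def)
  note K' = subfield_ring_on[OF K] and L' = subfield_ring_on[OF Khat]
  note Kbar = subfield_alg_clos[OF K']
  have polys: "p \<in> polys_over (alg_clos Khat)" for p by (simp add: closure polys_over_def)
  have a: "a \<in> alg_clos K" using pair by (simp add: is_pair_of_definition_def)
  \<comment> \<open>The precision \<open>e\<close> ranges over the whole closure; cofinality
    replaces it by an element of \<open>Khat\<close>, where density applies.\<close>
  have dense: "\<exists>y\<in>K. w e < w (x - y)" if x: "x \<in> Khat" and e: "e \<noteq> 0" for x e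
  proof -
    obtain c where c: "c \<in> Khat" "c \<noteq> 0" "w e \<le> w c" using cofinal_subfield[OF L' _ e] closure by auto
    obtain g where "w c = Fin g" using w_Fin[OF c(2)] by blast
    then obtain y where "y \<in> K" "w c < w (x - y)" using dense_in_ring_on[OF Khat sub dns x c(1)] by blast
    then show ?thesis using c(3) order.strict_trans1 by blast
  qed
  \<comment> \<open>Uniqueness of the pair yields this only for constants algebraic over
    \<open>K\<close>. For general \<open>c\<close>, an element of \<open>Khat\<close> bounds its
    value, and an approximation in \<open>K\<close> has the same value as that element.\<close>
  have dominant: "w c < Fin \<gamma>" if c: "c \<noteq> 0" for c
  proof -
    obtain x where x: "x \<in> Khat" "x \<noteq> 0" "w c \<le> w x" using cofinal_subfield[OF L' _ c] closure by auto
    obtain y where y: "y \<in> K" "w x < w (x - y)" using dense[OF x(1,2)] by blast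
    have "w y = w x" using w_add_eq[of x "y - x"] y(2) by (simp add: w_diff_commute[of y x])
    moreover have "y \<noteq> 0" using y(2) by auto
    then have "w y < Fin \<gamma>"
      using unique_pair_dominant[OF Kbar pair] pair_unique w_extends subset_alg_clos[OF K'] y(1) by blast
    ultimately show ?thesis using x(3) by simp
  qed
  have v_eq: "v (to_fract p) = vhat (to_fract p)" if p: "p \<in> polys_over (alg_clos K)" for p
  proof -
    have "v (to_fract p) = pair_value (\<lambda>c. v (to_fract [:c:])) a \<gamma> p"
      using pair p by (simp add: is_pair_of_definition_def is_pair_valuation_def)
    also have "\<dots> = pair_value w a \<gamma> p" using pair_value_cong[OF Kbar p a] w_extends by metis
    also have "\<dots> = vhat (to_fract p)" using vhat polys by (simp add: is_pair_valuation_def)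
    finally show ?thesis .
  qed
  have KKbar: "p \<in> polys_over (alg_clos K)" if "p \<in> polys_over K" for p
    using that subset_alg_clos[OF K'] by (auto simp: polys_over_def)
  interpret dense_dominant_pair w a \<gamma> vhat K Khat v
  proof (intro dense_dominant_pair.intro dominant_pair.intro dense_dominant_pair_axioms.intro
      dominant_pair_axioms.intro alg_closed_valuation_axioms)
    have vf: "valued_field (ring_on (ratfuns_over (alg_clos Khat))) vhat"
      using vhat by (simp add: is_pair_valuation_def)
    have "to_fract p \<in> ratfuns_over (alg_clos Khat)" for p
      using polys unfolding ratfuns_over_def to_fract_def by (intro CollectI exI[of _ p] exI[of _ 1]) auto
    then show "vhat (to_fract (p * q)) = vhat (to_fract p) + vhat (to_fract q)" for p q
      using valued_field.mult[OF vf, of "to_fract p" "to_fract q"] by simp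
    show "vhat (to_fract p) = pair_value w a \<gamma> p" for p
      using vhat polys by (simp add: is_pair_valuation_def)
    show "v (to_fract p) = vhat (to_fract p)" if "p \<in> polys_over K" for p
      using that by (intro v_eq KKbar)
    \<comment> \<open>Roots of \<open>p\<close> are algebraic over \<open>K\<close>, so each
      \<open>X - b\<close> lies where \<open>v\<close> and \<open>vhat\<close> agree.\<close>
    show "delta v p = delta vhat p" if "p \<in> polys_over K" "0 < degree p" for p
    proof -
      have "v (to_fract [:- b, 1:]) = vhat (to_fract [:- b, 1:])" if "poly p b = 0" for b
      proof (rule v_eq)
        have "p \<noteq> 0" using \<open>0 < degree p\<close> by auto
        then have "b \<in> alg_clos K" using \<open>p \<in> polys_over K\<close> that by (auto simp: alg_clos_def)
        then show "[:- b, 1:] \<in> polys_over (alg_clos K)"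
          using subfield_ring_on_closed[OF Kbar] polys_over_0[OF Kbar] by (simp add: polys_over_pCons_iff[OF Kbar])
      qed
      then have "{v (to_fract [:- b, 1:]) | b. poly p b = 0} = {vhat (to_fract [:- b, 1:]) | b. poly p b = 0}"
        by metis
      then show ?thesis by (simp add: delta_def)
    qed
  qed (use K' L' sub dense dominant in auto)
  have "Qa \<notin> Q ` \<Lambda>" using remaining by auto
  moreover have "{P \<in> Q ` \<Lambda>. degree P \<le> degree Qa_hat} = Q ` {\<nu>\<in>\<Lambda>. degree (Q \<nu>) \<le> degree Qa_hat}" by auto
  ultimately show ?thesis using complete_sequence_lift[OF Qa_hat seq Qa] by simp
qed

end
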